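(* Let $\mathcal H$ be a Hilbert space, $\Delta$ a self-adjoint positive definite operator in $\mathcal H$, $D=\Delta^{1/2}$, and $PW_\omega=PW_\omega(D)$. Then for every $f\in\mathcal H$ there exist a sequence of bandlimited vectors $f_j=f_j(f)\in PW_{2^{j+1}}$ ($j=0,1,2,\dots$) and a vector $g\in PW_1$, a sequence of operators $S_j:\mathcal H\to PW_{2^{j+1}}$ and an operator $S:\mathcal H\to PW_1$, such that $$f=S(g)+\sum_{j=0}^\infty S_j(f_j)$$ with convergence in $\mathcal H$.
   Context: "Operator" $\mathcal H\to PW_\omega$ means bounded linear operator on $\mathcal H$ with range in $PW_\omega$. $\Delta$ is a self-adjoint, positive definite (in general unbounded) operator whose spectral measure is concentrated on $(0,\infty)$ (in particular $\{0\}$ has zero spectral projection). For $\omega>0$, the Paley–Wiener space $PW_\omega(D)$ is the set of $f\in\mathcal H$ such that the support of the spectral Fourier transform $\mathcal F_Df$ is contained in $[0,\omega]$; here $\mathcal F_D$ is a unitary map from $\mathcal H$ onto a direct integral $X=\int X(\lambda)\,dm(\lambda)$ over $[0,\infty)$, which maps the domain of $D^k$ onto $\{x\in X:\lambda^kx\in X\}$ with $\mathcal F_D(D^kf)=\lambda^k\mathcal F_Df$. Equivalently, $PW_\omega(D)$ is the range of the spectral projection of $D$ for $[0,\omega]$. Its elements are called bandlimited. *)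

theory Defs
  imports "HOL-Analysis.Analysis"
begin

section \<open>Complex Hilbert spaces\<close>

text \<open>The inner product is linear in the first argument and conjugate-linear in the second;
  it induces the norm, and completeness comes from \<^class>\<open>banach\<close>.\<close>

class complex_hilbert = banach +
  fixes scaleC :: "complex \<Rightarrow> 'a \<Rightarrow> 'a"  (infixr "*\<^sub>C" 75)
    and cinner :: "'a \<Rightarrow> 'a \<Rightarrow> complex"
  assumes scaleC_add_right: "c *\<^sub>C (x + y) = c *\<^sub>C x + c *\<^sub>C y"
    and scaleC_add_left: "(c + d) *\<^sub>C x = c *\<^sub>C x + d *\<^sub>C x"
    and scaleC_scaleC: "c *\<^sub>C d *\<^sub>C x = (c * d) *\<^sub>C x"
    and scaleR_scaleC: "r *\<^sub>R x = complex_of_real r *\<^sub>C x"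
    and cinner_commute: "cinner x y = cnj (cinner y x)"
    and cinner_add_left: "cinner (x + y) z = cinner x z + cinner y z"
    and cinner_scaleC_left: "cinner (c *\<^sub>C x) y = c * cinner x y"
    and cinner_self: "cinner x x = complex_of_real ((norm x)\<^sup>2)"

definition bounded_clinear :: "('a::complex_hilbert \<Rightarrow> 'a) \<Rightarrow> bool" where
  "bounded_clinear T \<longleftrightarrow> bounded_linear T \<and> (\<forall>c x. T (c *\<^sub>C x) = c *\<^sub>C T x)"

definition orthogonal_projection :: "('a::complex_hilbert \<Rightarrow> 'a) \<Rightarrow> bool" where
  "orthogonal_projection P \<longleftrightarrow>
     bounded_clinear P \<and> P \<circ> P = P \<and> (\<forall>x y. cinner (P x) y = cinner x (P y))"


section \<open>Unbounded operators\<close>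

text \<open>An operator (in general unbounded and only partially defined) is represented by its graph:
  \<open>(x, y) \<in> A\<close> means that \<open>x\<close> is in the domain of \<open>A\<close> and \<open>A x = y\<close>.
  So \<^const>\<open>Domain\<close> is the domain of the operator, and equality of operators includes equality
  of domains.\<close>

type_synonym 'a operator_graph = "('a \<times> 'a) set"

definition linear_operator :: "'a::complex_hilbert operator_graph \<Rightarrow> bool" where
  "linear_operator A \<longleftrightarrow> single_valued A \<and> (0, 0) \<in> A \<and>
     (\<forall>x y x' y'. (x, y) \<in> A \<longrightarrow> (x', y') \<in> A \<longrightarrow> (x + x', y + y') \<in> A) \<and>
     (\<forall>c x y. (x, y) \<in> A \<longrightarrow> (c *\<^sub>C x, c *\<^sub>C y) \<in> A)"

definition densely_defined :: "'a::complex_hilbert operator_graph \<Rightarrow> bool" where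
  "densely_defined A \<longleftrightarrow> closure (Domain A) = UNIV"

definition adjoint_operator :: "'a::complex_hilbert operator_graph \<Rightarrow> 'a operator_graph" where
  "adjoint_operator A = {(u, v). \<forall>(x, y) \<in> A. cinner y u = cinner x v}"

definition self_adjoint :: "'a::complex_hilbert operator_graph \<Rightarrow> bool" where
  "self_adjoint A \<longleftrightarrow> linear_operator A \<and> densely_defined A \<and> adjoint_operator A = A"

definition positive_definite :: "'a::complex_hilbert operator_graph \<Rightarrow> bool" where
  "positive_definite A \<longleftrightarrow>
     (\<forall>(x, y) \<in> A. x \<noteq> 0 \<longrightarrow> cinner y x \<in> \<real> \<and> 0 < Re (cinner y x))"


section \<open>Spectral measures and the functional calculus\<close>

definition projection_valued_measure :: "(real set \<Rightarrow> 'a::complex_hilbert \<Rightarrow> 'a) \<Rightarrow> bool" where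
  "projection_valued_measure E \<longleftrightarrow>
     (\<forall>B \<in> sets borel. orthogonal_projection (E B)) \<and> E UNIV = id \<and>
     (\<forall>B :: nat \<Rightarrow> real set. range B \<subseteq> sets borel \<longrightarrow> disjoint_family B \<longrightarrow>
        (\<forall>x. (\<lambda>n. E (B n) x) sums E (\<Union>n. B n) x))"

text \<open>The finite Borel measure \<open>B \<mapsto> \<langle>E(B) x, x\<rangle>\<close>.\<close>

definition scalar_measure ::
    "(real set \<Rightarrow> 'a::complex_hilbert \<Rightarrow> 'a) \<Rightarrow> 'a \<Rightarrow> real measure" where
  "scalar_measure E x = measure_of UNIV (sets borel) (\<lambda>B. ennreal (Re (cinner (E B x) x)))"

text \<open>The integral of \<open>\<phi>\<close> against the complex measure \<open>B \<mapsto> \<langle>E(B) x, y\<rangle>\<close>, which polarization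
  writes as a combination of four positive measures.\<close>

definition spectral_form ::
    "(real set \<Rightarrow> 'a::complex_hilbert \<Rightarrow> 'a) \<Rightarrow> (real \<Rightarrow> real) \<Rightarrow> 'a \<Rightarrow> 'a \<Rightarrow> complex" where
  "spectral_form E \<phi> x y =
     (\<Sum>k<4. \<i> ^ k * complex_of_real
        (integral\<^sup>L (scalar_measure E (x + (\<i> ^ k) *\<^sub>C y)) \<phi>)) / 4"

definition spectral_domain ::
    "(real set \<Rightarrow> 'a::complex_hilbert \<Rightarrow> 'a) \<Rightarrow> (real \<Rightarrow> real) \<Rightarrow> 'a set" where
  "spectral_domain E \<phi> = {x. integrable (scalar_measure E x) (\<lambda>t. (\<phi> t)\<^sup>2)}"

text \<open>The operator \<open>\<integral> \<phi> dE\<close>. Its domain is dense, so testing against \<open>z\<close> in the domain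
  determines \<open>y\<close>; this restriction makes the four integrals in the polarized form converge.\<close>

definition spectral_integral ::
    "(real set \<Rightarrow> 'a::complex_hilbert \<Rightarrow> 'a) \<Rightarrow> (real \<Rightarrow> real) \<Rightarrow> 'a operator_graph" where
  "spectral_integral E \<phi> =
     {(x, y). x \<in> spectral_domain E \<phi> \<and>
        (\<forall>z \<in> spectral_domain E \<phi>. cinner y z = spectral_form E \<phi> x z)}"

definition is_spectral_measure ::
    "'a::complex_hilbert operator_graph \<Rightarrow> (real set \<Rightarrow> 'a \<Rightarrow> 'a) \<Rightarrow> bool" where
  "is_spectral_measure A E \<longleftrightarrow>
     projection_valued_measure E \<and> A = spectral_integral E (\<lambda>t. t)"

text \<open>By the spectral theorem a self-adjoint operator has a spectral measure, and it is unique on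
  Borel sets; the values on other sets are irrelevant.\<close>

definition spectral_measure ::
    "'a::complex_hilbert operator_graph \<Rightarrow> real set \<Rightarrow> 'a \<Rightarrow> 'a" where
  "spectral_measure A = (SOME E. is_spectral_measure A E)"

text \<open>\<open>A\<^sup>1\<^sup>/\<^sup>2\<close> for a positive self-adjoint operator \<open>A\<close>. The spectral measure of such an \<open>A\<close>
  vanishes on the negative half-line, so the value of \<^const>\<open>sqrt\<close> there does not matter.\<close>

definition operator_sqrt :: "'a::complex_hilbert operator_graph \<Rightarrow> 'a operator_graph" where
  "operator_sqrt A = spectral_integral (spectral_measure A) sqrt"


section \<open>Paley--Wiener spaces\<close>

text \<open>The vectors whose spectral Fourier transform with respect to \<open>D\<close> is supported in
  \<open>[0, \<omega>]\<close>, that is, the range of the spectral projection of \<open>D\<close> for \<open>[0, \<omega>]\<close>.\<close>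

definition paley_wiener :: "'a::complex_hilbert operator_graph \<Rightarrow> real \<Rightarrow> 'a set" where
  "paley_wiener D \<omega> = range (spectral_measure D {0..\<omega>})"

end

(*
  The spectral theorem gives D a projection-valued measure G, and G vanishes on the negative
  half-line since D is nonnegative. Hence every f is the sum of its components in the dyadic bands
  [0, 1] and (2^j, 2^(j+1)], and one takes S and S_j to be the spectral projections of these bands
  and g and f_j to be the components of f.

  The spectral theorem is proved for a nonnegative self-adjoint operator A through its resolvent
  R = (1 + A)^(-1), a positive contraction. The numbers <R^k (1 - R)^l x, x> are nonnegative, so
  that they are the integrals of t^k (1 - t)^l against a measure mu_x on [0, 1] (Hausdorff's moment
  problem). Every algebraic relation between the measures mu_x holds because it holds for their
  moments; so the polarized measures are sesquilinear, define operators by Riesz representation,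
  and these are projections. The substitution t -> 1/t - 1 turns the spectral measure of R into
  that of A.
*)

theory Submission
  imports Defs "HOL-Probability.Probability"
begin

section \<open>Hilbert space geometry\<close>

text \<open>\<open>spectral_measure\<close> is a choice, so nothing is known of it until some
  spectral measure exists; existence is therefore proved twice, for \<Delta> and for
  \<open>operator_sqrt \<Delta>\<close>. The passage to \<open>1/t - 1\<close> and the one to
  \<open>sqrt\<close> are both images of scalar measures under a Borel map. The resolvent is used
  because its powers are defined everywhere and its spectral parameter stays in the compact interval
  [0,1], where polynomials are dense and moments determine a measure. Polarized measures are
  complex; they are treated as functionals on bounded Borel functions that respect bounded pointwise
  limits. Truncation and dominated convergence then carry the identities over to the unbounded
  function \<open>1/t - 1\<close>. That the operator obtained is \<open>A\<close> itself, and not a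
  proper extension, holds because a self-adjoint operator has no proper symmetric extension.\<close>

lemma cinner_add_right: "cinner x (y + z) = cinner x y + cinner x (z::'a::complex_hilbert)"
  by (metis cinner_commute cinner_add_left complex_cnj_add)

lemma cinner_scaleC_right: "cinner x (c *\<^sub>C y) = cnj c * cinner x (y::'a::complex_hilbert)"
  by (metis cinner_commute cinner_scaleC_left complex_cnj_mult)

lemma scaleC_one [simp]: "1 *\<^sub>C x = (x::'a::complex_hilbert)"
  using scaleR_scaleC[of 1 x] by simp

lemma scaleC_zero_left [simp]: "0 *\<^sub>C x = (0::'a::complex_hilbert)"
  using scaleR_scaleC[of 0 x] by simp

lemma scaleC_zero_right [simp]: "c *\<^sub>C 0 = (0::'a::complex_hilbert)"
  using scaleC_add_right[of c 0 0] by simp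

lemma scaleC_minus_one [simp]: "(- 1) *\<^sub>C x = - (x::'a::complex_hilbert)"
  using scaleR_scaleC[of "-1" x] by simp

lemma scaleC_minus_right: "c *\<^sub>C (- x) = - (c *\<^sub>C (x::'a::complex_hilbert))"
  using scaleC_add_right[of c x "- x"] by (simp add: eq_neg_iff_add_eq_0 add.commute)

lemma scaleC_diff_right: "c *\<^sub>C (x - y) = c *\<^sub>C x - c *\<^sub>C (y::'a::complex_hilbert)"
  using scaleC_add_right[of c x "- y"] by (simp add: scaleC_minus_right)

lemma cinner_zero_left [simp]: "cinner 0 x = 0"
  for x :: "'a::complex_hilbert"
  using cinner_scaleC_left[of 0 0 x] by simp

lemma cinner_zero_right [simp]: "cinner x 0 = 0"
  for x :: "'a::complex_hilbert"
  using cinner_scaleC_right[of x 0 0] by simp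

lemma cinner_minus_left: "cinner (- x) y = - cinner x y"
  for x :: "'a::complex_hilbert"
  using cinner_scaleC_left[of "-1" x y] by simp

lemma cinner_minus_right: "cinner x (- y) = - cinner x y"
  for x :: "'a::complex_hilbert"
  using cinner_scaleC_right[of x "-1" y] by simp

lemma cinner_diff_left: "cinner (x - y) z = cinner x z - cinner y z"
  for x :: "'a::complex_hilbert"
  using cinner_add_left[of x "- y" z] by (simp add: cinner_minus_left)

lemma cinner_diff_right: "cinner x (y - z) = cinner x y - cinner x z"
  for x :: "'a::complex_hilbert"
  using cinner_add_right[of x y "- z"] by (simp add: cinner_minus_right)

lemma cinner_scaleR_left: "cinner (r *\<^sub>R x) y = r * cinner x y"
  for x :: "'a::complex_hilbert"
  by (simp add: scaleR_scaleC cinner_scaleC_left)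

lemma cinner_scaleR_right: "cinner x (r *\<^sub>R y) = r * cinner x y"
  for x :: "'a::complex_hilbert"
  by (simp add: scaleR_scaleC cinner_scaleC_right)

lemma Re_cinner_self: "Re (cinner x x) = (norm x)\<^sup>2"
  for x :: "'a::complex_hilbert"
  by (simp add: cinner_self)

lemma cinner_self_zero [simp]: "cinner x x = 0 \<longleftrightarrow> x = 0"
  for x :: "'a::complex_hilbert"
  by (simp add: cinner_self)

lemma cinner_eqI:
  fixes x :: "'a::complex_hilbert"
  assumes "\<And>z. cinner x z = cinner y z"
  shows "x = y"
proof -
  have "cinner (x - y) (x - y) = 0"
    using assms by (simp only: cinner_diff_left) simp
  then show ?thesis by simp
qed

lemma mult_cnj_norm: "z * cnj z = (complex_of_real (cmod z))\<^sup>2"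
  using complex_norm_square[of z] by simp

lemma norm_scaleC: "norm (c *\<^sub>C x) = cmod c * norm x"
  for x :: "'a::complex_hilbert"
proof -
  have "complex_of_real ((norm (c *\<^sub>C x))\<^sup>2) = complex_of_real ((cmod c * norm x)\<^sup>2)"
    unfolding cinner_self[symmetric] cinner_scaleC_left cinner_scaleC_right
    by (simp add: cinner_self power_mult_distrib mult_cnj_norm mult.commute[of "cnj c" c] flip: mult.assoc)
  then have "(norm (c *\<^sub>C x))\<^sup>2 = (cmod c * norm x)\<^sup>2"
    using of_real_eq_iff by blast
  then show ?thesis by (simp add: power2_eq_iff_nonneg)
qed

lemma norm_add_sq: "(norm (x + y))\<^sup>2 = (norm x)\<^sup>2 + (norm y)\<^sup>2 + 2 * Re (cinner x y)"
  for x :: "'a::complex_hilbert"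
proof -
  have "Re (cinner y x) = Re (cinner x y)"
    by (subst cinner_commute) simp
  then show ?thesis
    unfolding Re_cinner_self[symmetric] cinner_add_left cinner_add_right by simp
qed

lemma norm_diff_sq: "(norm (x - y))\<^sup>2 = (norm x)\<^sup>2 + (norm y)\<^sup>2 - 2 * Re (cinner x y)"
  for x :: "'a::complex_hilbert"
  using norm_add_sq[of x "- y"] by (simp add: cinner_minus_right)

lemma parallelogram:
  "(norm (x + y))\<^sup>2 + (norm (x - y))\<^sup>2 = 2 * (norm x)\<^sup>2 + 2 * (norm y)\<^sup>2"
  for x :: "'a::complex_hilbert"
  by (simp add: norm_add_sq norm_diff_sq)

text \<open>The part of \<open>x\<close> orthogonal to \<open>z\<close> has nonnegative square norm; this gives both the
  Cauchy--Schwarz inequality and the orthogonality of the minimizer in the projection theorem.\<close>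

lemma norm_sq_minus_component:
  fixes x z :: "'a::complex_hilbert"
  assumes "z \<noteq> 0"
  shows "(norm (x - (cinner x z / (norm z)\<^sup>2) *\<^sub>C z))\<^sup>2 = (norm x)\<^sup>2 - (cmod (cinner x z))\<^sup>2 / (norm z)\<^sup>2"
proof -
  let ?c = "cinner x z / (norm z)\<^sup>2"
  have c: "cmod ?c = cmod (cinner x z) / (norm z)\<^sup>2"
    by (simp add: norm_divide norm_power)
  have "cinner x (?c *\<^sub>C z) = complex_of_real ((cmod (cinner x z))\<^sup>2 / (norm z)\<^sup>2)"
    by (simp add: cinner_scaleC_right mult_cnj_norm mult.commute[of "cnj (cinner x z)"])
  then have "Re (cinner x (?c *\<^sub>C z)) = (cmod (cinner x z))\<^sup>2 / (norm z)\<^sup>2"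
    by (simp only: Re_complex_of_real)
  moreover have "(norm (?c *\<^sub>C z))\<^sup>2 = (cmod (cinner x z))\<^sup>2 / (norm z)\<^sup>2"
    unfolding norm_scaleC c using assms by (simp add: field_simps power2_eq_square)
  ultimately show ?thesis
    by (simp add: norm_diff_sq)
qed

lemma cauchy_schwarz: "cmod (cinner x y) \<le> norm x * norm y"
  for x :: "'a::complex_hilbert"
proof (cases "y = 0")
  case False
  have "0 \<le> (norm x)\<^sup>2 - (cmod (cinner x y))\<^sup>2 / (norm y)\<^sup>2"
    by (metis norm_sq_minus_component[OF False] zero_le_power2)
  then have "(cmod (cinner x y))\<^sup>2 \<le> (norm x * norm y)\<^sup>2"
    using False by (simp add: field_simps power_mult_distrib)
  then show ?thesis by (simp add: power2_le_iff_abs_le)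
qed simp

lemma bounded_bilinear_cinner: "bounded_bilinear (cinner :: 'a::complex_hilbert \<Rightarrow> 'a \<Rightarrow> complex)"
  by (rule bounded_bilinear.intro)
    (auto simp: cinner_add_left cinner_add_right cinner_scaleR_left cinner_scaleR_right
      scaleR_conv_of_real intro!: exI[of _ 1] cauchy_schwarz)

lemmas tendsto_cinner = bounded_bilinear.tendsto[OF bounded_bilinear_cinner]

text \<open>A minimizing sequence for the distance from \<open>x\<close> to \<open>M\<close> is
  Cauchy by the parallelogram law, because midpoints stay in \<open>M\<close>; its limit is the foot
  of the perpendicular.\<close>

lemma orthogonal_decomposition:
  fixes M :: "'a::complex_hilbert set"
  assumes "closed M" and zero: "0 \<in> M"
    and add: "\<And>x y. x \<in> M \<Longrightarrow> y \<in> M \<Longrightarrow> x + y \<in> M"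
    and scale: "\<And>c x. x \<in> M \<Longrightarrow> c *\<^sub>C x \<in> M"
  obtains m where "m \<in> M" "\<And>z. z \<in> M \<Longrightarrow> cinner (x - m) z = 0"
proof -
  define q where "q = (INF m\<in>M. (norm (x - m))\<^sup>2)"
  have bdd: "bdd_below ((\<lambda>m. (norm (x - m))\<^sup>2) ` M)"
    by (auto intro!: bdd_belowI[of _ 0])
  have q_le: "q \<le> (norm (x - m))\<^sup>2" if "m \<in> M" for m
    unfolding q_def using bdd that by (rule cINF_lower)
  have "\<exists>m\<in>M. (norm (x - m))\<^sup>2 < q + inverse (real (Suc n))" for n
    using cINF_less_iff[of M "\<lambda>m. (norm (x - m))\<^sup>2" "q + inverse (real (Suc n))"] bdd zero
    unfolding q_def by (auto simp: inverse_eq_divide)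
  then obtain m where m: "\<And>n. m n \<in> M" "\<And>n. (norm (x - m n))\<^sup>2 < q + inverse (real (Suc n))"
    by metis
  have close: "(norm (m n - m k))\<^sup>2 \<le> 2 * inverse (real (Suc n)) + 2 * inverse (real (Suc k))" for n k
  proof -
    have "(1/2) *\<^sub>R (m n + m k) \<in> M"
      by (simp only: scaleR_scaleC) (intro scale add m)
    then have "q \<le> (norm (x - (1/2) *\<^sub>R (m n + m k)))\<^sup>2" by (rule q_le)
    moreover have "x - (1/2) *\<^sub>R (m n + m k) = (1/2) *\<^sub>R ((x - m n) + (x - m k))"
      by (simp add: algebra_simps flip: scaleR_add_left)
    ultimately have "4 * q \<le> (norm ((x - m n) + (x - m k)))\<^sup>2"
      by (simp add: power_divide)
    moreover have "(norm ((x - m n) - (x - m k)))\<^sup>2 = (norm (m n - m k))\<^sup>2"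
      by (simp add: norm_minus_commute)
    ultimately show ?thesis
      using parallelogram[of "x - m n" "x - m k"] m(2)[of n] m(2)[of k] by linarith
  qed
  have "Cauchy m"
  proof (rule CauchyI)
    fix e :: real assume "0 < e"
    then obtain N where N: "inverse (real (Suc N)) < e\<^sup>2 / 4"
      using reals_Archimedean[of "e\<^sup>2 / 4"] by auto
    have "norm (m n - m k) < e" if "N \<le> n" "N \<le> k" for n k
    proof -
      have "inverse (real (Suc n)) \<le> inverse (real (Suc N))" "inverse (real (Suc k)) \<le> inverse (real (Suc N))"
        using that by auto
      then have "(norm (m n - m k))\<^sup>2 < e\<^sup>2"
        using close[of n k] N by linarith
      then show ?thesis using \<open>0 < e\<close> by (simp add: power2_less_imp_less)
    qed
    then show "\<exists>N. \<forall>n\<ge>N. \<forall>k\<ge>N. norm (m n - m k) < e" by blast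
  qed
  then obtain l where l: "m \<longlonglongrightarrow> l"
    using Cauchy_convergent convergentD by blast
  have "l \<in> M" using \<open>closed M\<close> m(1) l closed_sequentially by blast
  have "(norm (x - l))\<^sup>2 \<le> q"
  proof (rule LIMSEQ_le)
    show "(\<lambda>n. (norm (x - m n))\<^sup>2) \<longlonglongrightarrow> (norm (x - l))\<^sup>2"
      by (intro tendsto_intros l)
    show "(\<lambda>n. q + inverse (real (Suc n))) \<longlonglongrightarrow> q"
      using tendsto_add[OF tendsto_const LIMSEQ_inverse_real_of_nat, of q] by simp
  qed (use m(2) less_imp_le in blast)
  show ?thesis
  proof
    show "l \<in> M" by fact
    fix z assume "z \<in> M"
    show "cinner (x - l) z = 0"
    proof (cases "z = 0")
      case False
      \<comment> \<open>The multiple of \<open>z\<close> that decreases the distance most;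
        minimality of \<open>l\<close> forces the decrease to be zero.\<close>
      let ?c = "cinner (x - l) z / (norm z)\<^sup>2"
      have "q \<le> (norm (x - (l + ?c *\<^sub>C z)))\<^sup>2"
        by (intro q_le add scale \<open>l \<in> M\<close> \<open>z \<in> M\<close>)
      also have "\<dots> = (norm (x - l))\<^sup>2 - (cmod (cinner (x - l) z))\<^sup>2 / (norm z)\<^sup>2"
        using norm_sq_minus_component[OF False, of "x - l"] by (simp add: algebra_simps)
      finally have "(cmod (cinner (x - l) z))\<^sup>2 / (norm z)\<^sup>2 \<le> 0"
        using \<open>(norm (x - l))\<^sup>2 \<le> q\<close> by linarith
      then show ?thesis using False by (simp add: divide_le_0_iff)
    qed simp
  qed
qed

text \<open>A bounded functional has a closed kernel. If it is not zero, a vector \<open>u\<close>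
  orthogonal to the kernel spans the rest of the space, and a multiple of \<open>u\<close>
  represents the functional.\<close>

lemma riesz_representation:
  fixes f :: "'a::complex_hilbert \<Rightarrow> complex"
  assumes add: "\<And>x y. f (x + y) = f x + f y" and scale: "\<And>c x. f (c *\<^sub>C x) = c * f x"
    and bound: "\<And>x. cmod (f x) \<le> K * norm x"
  shows "\<exists>v. \<forall>x. f x = cinner x v"
proof (cases "\<forall>x. f x = 0")
  case True
  then show ?thesis by (intro exI[of _ 0]) simp
next
  case False
  then obtain w where "f w \<noteq> 0" by blast
  have lin: "bounded_linear f"
    by (rule bounded_linear_intro[where K=K])
      (use bound in \<open>auto simp: add scaleR_scaleC scale scaleR_conv_of_real mult.commute\<close>)
  have "closed {x. f x = 0}"
    by (intro closed_Collect_eq bounded_linear.continuous_on[OF lin] continuous_intros)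
  moreover have "f 0 = 0" using scale[of 0 0] by simp
  ultimately obtain m where m: "f m = 0" "\<And>z. f z = 0 \<Longrightarrow> cinner (w - m) z = 0"
    using orthogonal_decomposition[of "{x. f x = 0}" w] by (auto simp: add scale)
  define u where "u = w - m"
  have fu: "f u = f w" using add[of "w - m" m] m(1) by (simp add: u_def)
  then have "u \<noteq> 0" using \<open>f 0 = 0\<close> \<open>f w \<noteq> 0\<close> by auto
  have neg: "f (- x) = - f x" for x using scale[of "-1" x] by simp
  \<comment> \<open>The conjugate undoes the conjugate-linearity of \<open>cinner\<close> in its
    second argument; the scalar is the one that gives the right value at \<open>u\<close>.\<close>
  have "f x = cinner x (cnj (f u / (norm u)\<^sup>2) *\<^sub>C u)" for x
  proof -
    have "f (x - (f x / f u) *\<^sub>C u) = 0"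
      using add[of x "- ((f x / f u) *\<^sub>C u)"] fu \<open>f w \<noteq> 0\<close> by (simp add: neg scale)
    then have "cinner u (x - (f x / f u) *\<^sub>C u) = 0" using m(2) by (simp add: u_def)
    then have "cinner (x - (f x / f u) *\<^sub>C u) u = 0"
      by (metis cinner_commute complex_cnj_zero)
    then have "cinner x u = (f x / f u) * (norm u)\<^sup>2"
      by (simp add: cinner_diff_left cinner_scaleC_left cinner_self)
    then show ?thesis
      using \<open>u \<noteq> 0\<close> fu \<open>f w \<noteq> 0\<close> by (simp add: cinner_scaleC_right)
  qed
  then show ?thesis by blast
qed

text \<open>The Riesz theorem represents functionals that are linear in \<open>y\<close>, whereas
  \<open>b x\<close> is conjugate-linear there. The form \<open>b'\<close> is the flipped conjugate
  of \<open>b\<close>, to which the theorem applies; for a Hermitian form the two coincide.\<close>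

lemma operator_of_form:
  fixes b :: "'a::complex_hilbert \<Rightarrow> 'a \<Rightarrow> complex"
  assumes addl: "\<And>x x' y. b (x + x') y = b x y + b x' y"
    and scalel: "\<And>c x y. b (c *\<^sub>C x) y = c * b x y"
    and herm: "\<And>x y. b' y x = cnj (b x y)"
    and addr: "\<And>x x' y. b' (x + x') y = b' x y + b' x' y"
    and scaler: "\<And>c x y. b' (c *\<^sub>C x) y = c * b' x y"
    and bound: "\<And>x y. cmod (b x y) \<le> K * norm x * norm y"
  obtains T where "bounded_clinear T" "\<And>x y. cinner (T x) y = b x y"
proof -
  have "\<exists>v. \<forall>y. b' y x = cinner y v" for x
  proof (rule riesz_representation[where K="K * norm x"])
    show "cmod (b' y x) \<le> K * norm x * norm y" for y
      using bound[of x y] by (simp add: herm)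
  qed (simp_all add: addr scaler)
  then obtain T where T: "\<And>x y. b' y x = cinner y (T x)" by metis
  have Tb: "cinner (T x) y = b x y" for x y
    by (metis T cinner_commute complex_cnj_cnj herm)
  have add: "T (x + x') = T x + T x'" for x x'
    by (rule cinner_eqI) (simp add: Tb cinner_add_left addl)
  have scale: "T (c *\<^sub>C x) = c *\<^sub>C T x" for c x
    by (rule cinner_eqI) (simp add: Tb cinner_scaleC_left scalel)
  have le: "norm (T x) \<le> norm x * K" for x
  proof (cases "T x = 0")
    case True
    \<comment> \<open>The sign of \<open>K\<close> is read off from \<open>bound\<close> at the pair
      \<open>x\<close>, \<open>x\<close>.\<close>
    have "0 \<le> K * norm x" if "x \<noteq> 0"
      using order_trans[OF norm_ge_zero bound[of x x]] that by (simp add: zero_le_mult_iff)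
    then show ?thesis using True by (cases "x = 0") (auto simp: mult.commute)
  next
    case False
    have "(norm (T x))\<^sup>2 \<le> K * norm x * norm (T x)"
      using bound[of x "T x"] by (simp add: cinner_self norm_power flip: Tb)
    then show ?thesis using False by (simp add: power2_eq_square mult.commute)
  qed
  have "bounded_linear T"
    by (rule bounded_linear_intro[where K=K]) (auto simp: add scale scaleR_scaleC le)
  then show ?thesis using that scale Tb by (auto simp: bounded_clinear_def)
qed

section \<open>Functionals on bounded Borel functions\<close>

definition bounded_borel :: "(real \<Rightarrow> real) \<Rightarrow> bool" where
  "bounded_borel \<phi> \<longleftrightarrow> \<phi> \<in> borel_measurable borel \<and> (\<exists>C. \<forall>t. \<bar>\<phi> t\<bar> \<le> C)"

text \<open>Linear functionals that respect bounded pointwise limits: the integrals against complex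
  measures, in a form that avoids complex measures.\<close>

definition sigma_functional :: "((real \<Rightarrow> real) \<Rightarrow> complex) \<Rightarrow> bool" where
  "sigma_functional \<Lambda> \<longleftrightarrow>
     (\<forall>\<phi> \<psi>. bounded_borel \<phi> \<longrightarrow> bounded_borel \<psi> \<longrightarrow> \<Lambda> (\<lambda>t. \<phi> t + \<psi> t) = \<Lambda> \<phi> + \<Lambda> \<psi>) \<and>
     (\<forall>a \<phi>. bounded_borel \<phi> \<longrightarrow> \<Lambda> (\<lambda>t. a * \<phi> t) = of_real a * \<Lambda> \<phi>) \<and>
     (\<forall>(\<phi> :: nat \<Rightarrow> real \<Rightarrow> real) \<psi> C. (\<forall>n. \<phi> n \<in> borel_measurable borel) \<longrightarrow> \<psi> \<in> borel_measurable borel \<longrightarrow>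
        (\<forall>n t. \<bar>\<phi> n t\<bar> \<le> C) \<longrightarrow> (\<forall>t. (\<lambda>n. \<phi> n t) \<longlonglongrightarrow> \<psi> t) \<longrightarrow> (\<lambda>n. \<Lambda> (\<phi> n)) \<longlonglongrightarrow> \<Lambda> \<psi>)"

lemma bounded_borelI: "\<phi> \<in> borel_measurable borel \<Longrightarrow> (\<And>t. \<bar>\<phi> t\<bar> \<le> C) \<Longrightarrow> bounded_borel \<phi>"
  by (auto simp: bounded_borel_def)

lemma bounded_borel_measurable: "bounded_borel \<phi> \<Longrightarrow> \<phi> \<in> borel_measurable borel"
  by (simp add: bounded_borel_def)

lemma bounded_borel_const: "bounded_borel (\<lambda>t. c)"
  by (rule bounded_borelI[where C="\<bar>c\<bar>"]) auto

lemma bounded_borel_add: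
  assumes "bounded_borel \<phi>" "bounded_borel \<psi>"
  shows "bounded_borel (\<lambda>t. \<phi> t + \<psi> t)"
proof -
  obtain C K where C: "\<And>t. \<bar>\<phi> t\<bar> \<le> C" and K: "\<And>t. \<bar>\<psi> t\<bar> \<le> K"
    using assms by (auto simp: bounded_borel_def)
  show ?thesis
  proof (rule bounded_borelI)
    show "\<bar>\<phi> t + \<psi> t\<bar> \<le> C + K" for t using C[of t] K[of t] by linarith
  qed (use assms[THEN bounded_borel_measurable] in measurable)
qed

lemma bounded_borel_mult:
  assumes "bounded_borel \<phi>" "bounded_borel \<psi>"
  shows "bounded_borel (\<lambda>t. \<phi> t * \<psi> t)"
proof -
  obtain C K where C: "\<And>t. \<bar>\<phi> t\<bar> \<le> C" and K: "\<And>t. \<bar>\<psi> t\<bar> \<le> K"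
    using assms by (auto simp: bounded_borel_def)
  show ?thesis
  proof (rule bounded_borelI)
    show "\<bar>\<phi> t * \<psi> t\<bar> \<le> C * K" for t
      unfolding abs_mult using C[of t] K[of t] by (intro mult_mono) auto
  qed (use assms[THEN bounded_borel_measurable] in measurable)
qed

lemma bounded_borel_diff: "bounded_borel \<phi> \<Longrightarrow> bounded_borel \<psi> \<Longrightarrow> bounded_borel (\<lambda>t. \<phi> t - \<psi> t)"
  using bounded_borel_add[of \<phi> "\<lambda>t. -1 * \<psi> t"] bounded_borel_mult[OF bounded_borel_const, of \<psi> "-1"]
  by simp

lemma bounded_borel_indicator: "B \<in> sets borel \<Longrightarrow> bounded_borel (indicator B)"
  by (rule bounded_borelI[where C=1]) (auto simp: indicator_def)

lemma bounded_borel_indicator_mult: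
  assumes "B \<in> sets borel" "\<phi> \<in> borel_measurable borel" "\<And>t. t \<in> B \<Longrightarrow> \<bar>\<phi> t\<bar> \<le> C"
  shows "bounded_borel (\<lambda>t. indicator B t * \<phi> t)"
proof (rule bounded_borelI)
  show "(\<lambda>t. indicator B t * \<phi> t) \<in> borel_measurable borel"
    using assms(1,2) by simp
  show "\<bar>indicator B t * \<phi> t\<bar> \<le> max C 0" for t
    using assms(3)[of t] by (auto simp: indicator_def)
qed

lemma bounded_borel_sum: "(\<And>i. i \<in> I \<Longrightarrow> bounded_borel (\<phi> i)) \<Longrightarrow> bounded_borel (\<lambda>t. \<Sum>i\<in>I. \<phi> i t)"
  by (induction I rule: infinite_finite_induct) (auto intro: bounded_borel_add bounded_borel_const)

lemma bounded_borel_01_power: "bounded_borel (\<lambda>t. indicator {0..1} t * t ^ n)"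
  by (rule bounded_borel_indicator_mult[where C=1]) (auto simp: power_le_one)

lemmas bounded_borel_intros = bounded_borel_const bounded_borel_add bounded_borel_mult
  bounded_borel_diff bounded_borel_indicator bounded_borel_sum bounded_borel_01_power

section \<open>Uniqueness of functionals: indicators, rays, moments\<close>

context
  fixes \<Lambda> :: "(real \<Rightarrow> real) \<Rightarrow> complex"
  assumes \<Lambda>: "sigma_functional \<Lambda>"
begin

lemma sf_plus: "bounded_borel \<phi> \<Longrightarrow> bounded_borel \<psi> \<Longrightarrow> \<Lambda> (\<lambda>t. \<phi> t + \<psi> t) = \<Lambda> \<phi> + \<Lambda> \<psi>"
  using \<Lambda> unfolding sigma_functional_def by blast

lemma sf_times: "bounded_borel \<phi> \<Longrightarrow> \<Lambda> (\<lambda>t. a * \<phi> t) = of_real a * \<Lambda> \<phi>"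
  using \<Lambda> unfolding sigma_functional_def by blast

lemma sf_minus: "bounded_borel \<phi> \<Longrightarrow> bounded_borel \<psi> \<Longrightarrow> \<Lambda> (\<lambda>t. \<phi> t - \<psi> t) = \<Lambda> \<phi> - \<Lambda> \<psi>"
  using sf_plus[of \<phi> "\<lambda>t. -1 * \<psi> t"] sf_times[of \<psi> "-1"]
    bounded_borel_mult[OF bounded_borel_const, of \<psi> "-1"] by simp

lemma sf_zero: "\<Lambda> (\<lambda>t. 0) = 0"
  using sf_times[of "\<lambda>t. 0" 0] by (simp add: bounded_borel_const)

lemma sf_sum_fun: "(\<And>i. i \<in> I \<Longrightarrow> bounded_borel (\<phi> i)) \<Longrightarrow> \<Lambda> (\<lambda>t. \<Sum>i\<in>I. \<phi> i t) = (\<Sum>i\<in>I. \<Lambda> (\<phi> i))"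
proof (induction I rule: infinite_finite_induct)
  case (insert i I)
  then show ?case by (simp add: sf_plus bounded_borel_sum)
qed (auto simp: sf_zero)

lemma sf_limit:
  assumes "\<And>n. \<phi> n \<in> borel_measurable borel" "\<psi> \<in> borel_measurable borel"
    "\<And>n t. \<bar>\<phi> n t\<bar> \<le> C" "\<And>t. (\<lambda>n. \<phi> n t) \<longlonglongrightarrow> \<psi> t"
  shows "(\<lambda>n. \<Lambda> (\<phi> n)) \<longlonglongrightarrow> \<Lambda> \<psi>"
  using \<Lambda> assms unfolding sigma_functional_def by blast

lemma sf_limit_zero:
  assumes "\<And>n. \<phi> n \<in> borel_measurable borel" "\<psi> \<in> borel_measurable borel"
    "\<And>n t. \<bar>\<phi> n t\<bar> \<le> C" "\<And>t. (\<lambda>n. \<phi> n t) \<longlonglongrightarrow> \<psi> t" "\<And>n. \<Lambda> (\<phi> n) = 0"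
  shows "\<Lambda> \<psi> = 0"
proof -
  have "(\<lambda>n. \<Lambda> (\<phi> n)) \<longlonglongrightarrow> \<Lambda> \<psi>" by (rule sf_limit) (use assms in auto)
  then show ?thesis using assms(5) by (simp add: LIMSEQ_const_iff)
qed

text \<open>Simple functions are combinations of indicators. Their approximation with base point 0
  satisfies \<open>|s| \<le> 2 * |\<phi>|\<close>, which supplies the uniform bound that
  \<open>sf_limit\<close> asks for.\<close>

lemma sf_zero_if_zero_on_indicators:
  assumes ind: "\<And>B. B \<in> sets borel \<Longrightarrow> \<Lambda> (indicator B) = 0" and \<phi>: "bounded_borel \<phi>"
  shows "\<Lambda> \<phi> = 0"
proof -
  obtain C where C: "\<And>t. \<bar>\<phi> t\<bar> \<le> C" using \<phi> by (auto simp: bounded_borel_def)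
  note meas = bounded_borel_measurable[OF \<phi>]
  obtain s where s: "\<And>i. simple_function borel (s i)" "\<And>t. (\<lambda>i. s i t) \<longlonglongrightarrow> \<phi> t"
    "\<And>i t. \<bar>s i t\<bar> \<le> 2 * \<bar>\<phi> t\<bar>"
    using borel_measurable_implies_sequence_metric[OF meas, of 0] by (auto simp: dist_real_def)
  show ?thesis
  proof (rule sf_limit_zero)
    show "s n \<in> borel_measurable borel" for n using s(1) by (rule borel_measurable_simple_function)
    show "\<bar>s n t\<bar> \<le> 2 * C" for n t using s(3)[of n t] C[of t] by linarith
    fix n
    have fin: "finite (range (s n))" and pre: "\<And>y. s n -` {y} \<in> sets borel"
      using simple_functionD[OF s(1)[of n]] by auto
    have "s n t = (\<Sum>y\<in>range (s n). y * indicator (s n -` {y}) t)" for t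
      by (subst simple_function_indicator_representation_banach[OF s(1)[of n], of t])
        (simp_all add: mult.commute)
    then have "s n = (\<lambda>t. \<Sum>y\<in>range (s n). y * indicator (s n -` {y}) t)"
      by (rule ext)
    then have "\<Lambda> (s n) = \<Lambda> (\<lambda>t. \<Sum>y\<in>range (s n). y * indicator (s n -` {y}) t)"
      by (rule arg_cong)
    also have "\<dots> = (\<Sum>y\<in>range (s n). \<Lambda> (\<lambda>t. y * indicator (s n -` {y}) t))"
      by (intro sf_sum_fun bounded_borel_intros pre)
    also have "\<dots> = 0"
      by (intro sum.neutral ballI) (subst sf_times, auto intro: bounded_borel_indicator pre simp: ind pre)
    finally show "\<Lambda> (s n) = 0" .
  qed (use s(2) meas in auto)
qed

text \<open>Dynkin's argument: rays are closed under intersection and generate the Borel sets, and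
  the sets whose indicator is sent to 0 are closed under complements, thanks to \<open>one\<close>,
  and under disjoint countable unions.\<close>

lemma sf_zero_if_zero_on_rays:
  assumes ray: "\<And>a. \<Lambda> (indicator {a<..}) = 0" and one: "\<Lambda> (\<lambda>t. 1) = 0" and \<phi>: "bounded_borel \<phi>"
  shows "\<Lambda> \<phi> = 0"
proof (rule sf_zero_if_zero_on_indicators[OF _ \<phi>])
  fix B :: "real set" assume "B \<in> sets borel"
  let ?G = "range greaterThan :: real set set"
  have gen: "sets borel = sigma_sets UNIV ?G"
    by (simp add: borel_Ioi)
  have stable: "Int_stable ?G"
  proof (rule Int_stableI)
    fix a b :: "real set" assume "a \<in> ?G" "b \<in> ?G"
    then obtain c d where "a = {c<..}" "b = {d<..}" by auto
    then have "a \<inter> b = {max c d<..}" by auto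
    then show "a \<inter> b \<in> ?G" by blast
  qed
  have closed: "?G \<subseteq> Pow UNIV" by simp
  have "B \<in> sigma_sets UNIV ?G" using \<open>B \<in> sets borel\<close> gen by simp
  from stable closed this show "\<Lambda> (indicator B) = 0"
  proof (induction rule: sigma_sets_induct_disjoint)
    case (basic A)
    then show ?case using ray by auto
  next
    case empty
    then show ?case using sf_zero by simp
  next
    case (compl A)
    then have "A \<in> sets borel" using gen by simp
    have "indicator (UNIV - A) = (\<lambda>t. 1 - indicator A t :: real)"
      by (auto simp: indicator_def)
    then show ?case
      using sf_minus[OF bounded_borel_const bounded_borel_indicator[OF \<open>A \<in> sets borel\<close>], of 1] one compl
      by simp
  next
    case (union A)
    then have A: "A i \<in> sets borel" for i using gen by auto
    show ?case
    proof (rule sf_limit_zero)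
      have disj: "disjoint_family_on A I" for I
        using union(1) by (auto simp: disjoint_family_on_def)
      show "(\<lambda>n. \<Sum>i<n. indicator (A i) t) \<longlonglongrightarrow> (indicator (\<Union>i. A i) t :: real)" for t
        using indicator_sums[of A t] union(1) by (auto simp: sums_def disjoint_family_on_def)
      show "\<bar>\<Sum>i<n. indicator (A i) t\<bar> \<le> (1::real)" for n t
        by (simp add: indicator_UN_disjoint[OF finite_lessThan disj, symmetric])
      show "\<Lambda> (\<lambda>t. \<Sum>i<n. indicator (A i) t) = 0" for n
        using A union(3) by (subst sf_sum_fun) (auto intro: bounded_borel_indicator)
    qed (use A in auto)
  qed
qed

text \<open>By Weierstrass, vanishing moments kill every bounded continuous function, and indicators
  of rays are limits of continuous ramps. The factor \<open>indicator {0..1}\<close> makes the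
  powers bounded, so that the linearity of \<Lambda> covers them.\<close>

lemma sf_zero_if_moments_zero:
  assumes supp: "\<And>\<phi>. bounded_borel \<phi> \<Longrightarrow> (\<And>t. t \<in> {0..1} \<Longrightarrow> \<phi> t = 0) \<Longrightarrow> \<Lambda> \<phi> = 0"
    and moments: "\<And>n. \<Lambda> (\<lambda>t. indicator {0..1} t * t ^ n) = 0" and \<phi>: "bounded_borel \<phi>"
  shows "\<Lambda> \<phi> = 0"
proof -
  have cont: "\<Lambda> f = 0" if f: "continuous_on UNIV f" and C: "\<And>t. \<bar>f t\<bar> \<le> C" for f :: "real \<Rightarrow> real" and C
  proof -
    have bf: "bounded_borel f" using C by (intro bounded_borelI borel_measurable_continuous_onI f)
    have "\<exists>g. real_polynomial_function g \<and> (\<forall>t\<in>{0..1}. \<bar>f t - g t\<bar> < inverse (real (Suc n)))" for n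
    proof -
      have "0 < inverse (real (Suc n))" by simp
      from Stone_Weierstrass_real_polynomial_function[OF compact_Icc continuous_on_subset[OF f subset_UNIV] this, of 0 1]
      show ?thesis by metis
    qed
    then obtain g where g: "\<And>n. real_polynomial_function (g n)"
      "\<And>n t. t \<in> {0..1} \<Longrightarrow> \<bar>f t - g n t\<bar> < inverse (real (Suc n))" by metis
    have "\<Lambda> (\<lambda>t. indicator {0..1} t * f t) = 0"
    proof (rule sf_limit_zero[where C="C + 1"])
      fix n
      obtain a d where g_eq: "g n = (\<lambda>x. \<Sum>i\<le>d. a i * x ^ i)"
        using g(1)[of n] real_polynomial_function_iff_sum by metis
      show "(\<lambda>t. indicator {0..1} t * g n t) \<in> borel_measurable borel"
        unfolding g_eq by measurable
      show "\<bar>indicator {0..1} t * g n t\<bar> \<le> C + 1" for t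
      proof -
        have "inverse (real (Suc n)) \<le> 1" by (simp add: field_simps)
        then show ?thesis
          using g(2)[of t n] C[of t] by (auto simp: indicator_def)
      qed
      have "\<Lambda> (\<lambda>t. indicator {0..1} t * g n t) = \<Lambda> (\<lambda>t. \<Sum>i\<le>d. a i * (indicator {0..1} t * t ^ i))"
        unfolding g_eq by (simp add: sum_distrib_left mult.left_commute)
      also have "\<dots> = (\<Sum>i\<le>d. \<Lambda> (\<lambda>t. a i * (indicator {0..1} t * t ^ i)))"
        by (intro sf_sum_fun bounded_borel_intros)
      also have "\<dots> = 0"
        by (intro sum.neutral ballI) (subst sf_times, auto intro: bounded_borel_01_power simp: moments)
      finally show "\<Lambda> (\<lambda>t. indicator {0..1} t * g n t) = 0" .
    next
      show "(\<lambda>t. indicator {0..1} t * f t) \<in> borel_measurable borel"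
        using bounded_borel_measurable[OF bf] by measurable
      fix t
      show "(\<lambda>n. indicator {0..1} t * g n t) \<longlonglongrightarrow> indicator {0..1} t * f t"
      proof (cases "t \<in> {0..1}")
        case True
        have "(\<lambda>n. g n t) \<longlonglongrightarrow> f t"
          by (rule LIMSEQ_norm_0[of "\<lambda>n. g n t - f t", THEN LIM_zero_cancel])
            (use g(2)[OF True] in \<open>auto simp: abs_minus_commute inverse_eq_divide\<close>)
        then show ?thesis using True by simp
      qed simp
    qed
    moreover have "\<Lambda> (\<lambda>t. f t - indicator {0..1} t * f t) = 0"
      by (intro supp bounded_borel_intros bf) auto
    ultimately show ?thesis
      using sf_minus[OF bf bounded_borel_mult[OF bounded_borel_indicator bf], of "{0..1}"] by simp
  qed
  show ?thesis
  proof (rule sf_zero_if_zero_on_rays[OF _ _ \<phi>])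
    show "\<Lambda> (\<lambda>t. 1) = 0" by (rule cont[where C=1]) auto
    fix a :: real
    show "\<Lambda> (indicator {a<..}) = 0"
    proof (rule sf_limit_zero[where C=1])
      \<comment> \<open>For \<open>n > 0\<close> this ramp rises from 0 at \<open>a\<close> to 1 at
        \<open>a + 1/n\<close>. It is 0 at \<open>a\<close> itself, as the open ray demands.\<close>
      show "\<Lambda> (\<lambda>t. min 1 (max 0 (real n * (t - a)))) = 0" for n
        by (rule cont[where C=1]) (auto intro!: continuous_intros)
      fix t
      show "(\<lambda>n. min 1 (max 0 (real n * (t - a)))) \<longlonglongrightarrow> indicator {a<..} t"
      proof (cases "t > a")
        case True
        then obtain N where N: "1 < real N * (t - a)"
          using reals_Archimedean3[of "t - a"] by auto
        have "\<forall>\<^sub>F n in sequentially. min 1 (max 0 (real n * (t - a))) = indicator {a<..} t"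
        proof (rule eventually_sequentiallyI)
          fix n assume "N \<le> n"
          then have "real N * (t - a) \<le> real n * (t - a)"
            using True by (intro mult_right_mono) auto
          then have "1 \<le> real n * (t - a)" using N by linarith
          then show "min 1 (max 0 (real n * (t - a))) = indicator {a<..} t"
            using True by (simp add: min_absorb1)
        qed
        then show ?thesis by (rule tendsto_eventually)
      next
        case False
        then have "max 0 (real n * (t - a)) = 0" for n
          by (intro max_absorb1 mult_nonneg_nonpos) auto
        then show ?thesis using False by simp
      qed
    qed auto
  qed
qed

end

section \<open>Construction of functionals from given ones\<close>

lemma sigma_functional_integral:
  assumes "finite_measure M" and sets: "sets M = sets borel"
  shows "sigma_functional (\<lambda>\<phi>. complex_of_real (integral\<^sup>L M \<phi>))"
proof -
  interpret finite_measure M by fact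
  have meas: "\<phi> \<in> borel_measurable M \<longleftrightarrow> \<phi> \<in> borel_measurable borel" for \<phi> :: "real \<Rightarrow> real"
    using measurable_cong_sets[OF sets refl] by auto
  have int: "integrable M \<phi>" if bb: "bounded_borel \<phi>" for \<phi>
  proof -
    obtain C where "\<And>t. \<bar>\<phi> t\<bar> \<le> C" using bb by (auto simp: bounded_borel_def)
    then show ?thesis
      by (intro integrable_const_bound[where B=C]) (use bounded_borel_measurable[OF bb] in \<open>auto simp: meas\<close>)
  qed
  show ?thesis
    unfolding sigma_functional_def
  proof (intro conjI allI impI)
    fix \<phi> :: "nat \<Rightarrow> real \<Rightarrow> real" and \<psi> C
    assume a: "\<forall>n. \<phi> n \<in> borel_measurable borel" "\<psi> \<in> borel_measurable borel"
       "\<forall>n t. \<bar>\<phi> n t\<bar> \<le> C" "\<forall>t. (\<lambda>n. \<phi> n t) \<longlonglongrightarrow> \<psi> t"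
    show "(\<lambda>n. complex_of_real (integral\<^sup>L M (\<phi> n))) \<longlonglongrightarrow> complex_of_real (integral\<^sup>L M \<psi>)"
      by (intro tendsto_of_real integral_dominated_convergence[where w="\<lambda>_. C"])
         (use a in \<open>auto simp: meas\<close>)
  qed (auto simp: int)
qed

lemma sigma_functional_add:
  assumes "sigma_functional \<Lambda>" "sigma_functional \<Lambda>'"
  shows "sigma_functional (\<lambda>\<phi>. \<Lambda> \<phi> + \<Lambda>' \<phi>)"
  unfolding sigma_functional_def
proof (intro conjI allI impI)
  fix \<phi> :: "nat \<Rightarrow> real \<Rightarrow> real" and \<psi> C
  assume a: "\<forall>n. \<phi> n \<in> borel_measurable borel" "\<psi> \<in> borel_measurable borel"
     "\<forall>n t. \<bar>\<phi> n t\<bar> \<le> C" "\<forall>t. (\<lambda>n. \<phi> n t) \<longlonglongrightarrow> \<psi> t"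
  show "(\<lambda>n. \<Lambda> (\<phi> n) + \<Lambda>' (\<phi> n)) \<longlonglongrightarrow> \<Lambda> \<psi> + \<Lambda>' \<psi>"
    by (intro tendsto_add sf_limit[OF assms(1), where C=C] sf_limit[OF assms(2), where C=C]) (use a in auto)
qed (auto simp: sf_plus[OF assms(1)] sf_plus[OF assms(2)] sf_times[OF assms(1)] sf_times[OF assms(2)]
      algebra_simps)

lemma sigma_functional_scale:
  assumes "sigma_functional \<Lambda>"
  shows "sigma_functional (\<lambda>\<phi>. c * \<Lambda> \<phi>)"
  unfolding sigma_functional_def
proof (intro conjI allI impI)
  fix \<phi> :: "nat \<Rightarrow> real \<Rightarrow> real" and \<psi> C
  assume a: "\<forall>n. \<phi> n \<in> borel_measurable borel" "\<psi> \<in> borel_measurable borel"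
     "\<forall>n t. \<bar>\<phi> n t\<bar> \<le> C" "\<forall>t. (\<lambda>n. \<phi> n t) \<longlonglongrightarrow> \<psi> t"
  show "(\<lambda>n. c * \<Lambda> (\<phi> n)) \<longlonglongrightarrow> c * \<Lambda> \<psi>"
    by (intro tendsto_mult_left sf_limit[OF assms, where C=C]) (use a in auto)
qed (auto simp: sf_plus[OF assms] sf_times[OF assms] algebra_simps)

lemma sigma_functional_cnj:
  assumes "sigma_functional \<Lambda>"
  shows "sigma_functional (\<lambda>\<phi>. cnj (\<Lambda> \<phi>))"
  unfolding sigma_functional_def
proof (intro conjI allI impI)
  fix \<phi> :: "nat \<Rightarrow> real \<Rightarrow> real" and \<psi> C
  assume a: "\<forall>n. \<phi> n \<in> borel_measurable borel" "\<psi> \<in> borel_measurable borel"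
     "\<forall>n t. \<bar>\<phi> n t\<bar> \<le> C" "\<forall>t. (\<lambda>n. \<phi> n t) \<longlonglongrightarrow> \<psi> t"
  show "(\<lambda>n. cnj (\<Lambda> (\<phi> n))) \<longlonglongrightarrow> cnj (\<Lambda> \<psi>)"
    by (intro tendsto_cnj sf_limit[OF assms, where C=C]) (use a in auto)
qed (auto simp: sf_plus[OF assms] sf_times[OF assms] algebra_simps)

text \<open>Multiplication by a density. With it, the claim that one measure is \<open>h\<close>
  times another becomes an equality of functionals and can be tested on moments.\<close>

lemma sigma_functional_mult:
  assumes "sigma_functional \<Lambda>" "bounded_borel h"
  shows "sigma_functional (\<lambda>\<phi>. \<Lambda> (\<lambda>t. h t * \<phi> t))"
  unfolding sigma_functional_def
proof (intro conjI allI impI)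
  fix \<phi> :: "nat \<Rightarrow> real \<Rightarrow> real" and \<psi> C
  assume a: "\<forall>n. \<phi> n \<in> borel_measurable borel" "\<psi> \<in> borel_measurable borel"
     "\<forall>n t. \<bar>\<phi> n t\<bar> \<le> C" "\<forall>t. (\<lambda>n. \<phi> n t) \<longlonglongrightarrow> \<psi> t"
  obtain K where K: "\<And>t. \<bar>h t\<bar> \<le> K" using assms(2) by (auto simp: bounded_borel_def)
  show "(\<lambda>n. \<Lambda> (\<lambda>t. h t * \<phi> n t)) \<longlonglongrightarrow> \<Lambda> (\<lambda>t. h t * \<psi> t)"
  proof (rule sf_limit[OF assms(1)])
    show "\<bar>h t * \<phi> n t\<bar> \<le> K * C" for n t
      unfolding abs_mult by (intro mult_mono K) (use a K[of t] in \<open>auto intro: order_trans\<close>)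
  qed (use a bounded_borel_measurable[OF assms(2)] in
      \<open>auto intro!: tendsto_mult_left borel_measurable_times\<close>)
next
  fix \<phi> \<psi> assume "bounded_borel \<phi>" "bounded_borel \<psi>"
  then show "\<Lambda> (\<lambda>t. h t * (\<phi> t + \<psi> t)) = \<Lambda> (\<lambda>t. h t * \<phi> t) + \<Lambda> (\<lambda>t. h t * \<psi> t)"
    using sf_plus[OF assms(1)] assms(2) by (simp add: distrib_left bounded_borel_mult)
next
  fix a \<phi> assume "bounded_borel \<phi>"
  then show "\<Lambda> (\<lambda>t. h t * (a * \<phi> t)) = of_real a * \<Lambda> (\<lambda>t. h t * \<phi> t)"
    using sf_times[OF assms(1), of "\<lambda>t. h t * \<phi> t" a] assms(2) by (simp add: mult.left_commute bounded_borel_mult)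
qed

lemma sigma_functional_diff:
  "sigma_functional \<Lambda> \<Longrightarrow> sigma_functional \<Lambda>' \<Longrightarrow> sigma_functional (\<lambda>\<phi>. \<Lambda> \<phi> - \<Lambda>' \<phi>)"
  using sigma_functional_add[OF _ sigma_functional_scale[of \<Lambda>' "-1"]] by simp

lemma sigma_functional_eqI:
  assumes "sigma_functional \<Lambda>" "sigma_functional \<Lambda>'" "bounded_borel \<phi>"
    and "\<And>B. B \<in> sets borel \<Longrightarrow> \<Lambda> (indicator B) = \<Lambda>' (indicator B)"
  shows "\<Lambda> \<phi> = \<Lambda>' \<phi>"
  using sf_zero_if_zero_on_indicators[OF sigma_functional_diff[OF assms(1,2)] _ assms(3)] assms(4)
  by simp

text \<open>Support in [0,1], stated through test functions since a functional has no measure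
  attached to it; in this form it passes to sums, multiples and conjugates.\<close>

definition concentrated_01 :: "((real \<Rightarrow> real) \<Rightarrow> complex) \<Rightarrow> bool" where
  "concentrated_01 \<Lambda> \<longleftrightarrow> (\<forall>\<phi>. bounded_borel \<phi> \<longrightarrow> (\<forall>t\<in>{0..1}. \<phi> t = 0) \<longrightarrow> \<Lambda> \<phi> = 0)"

text \<open>Moment determinacy, applied to the difference of the two functionals. For polarized
  measures it reduces each relation to an identity between powers of the resolvent.\<close>

lemma sigma_functional_eqI_moments:
  assumes "sigma_functional \<Lambda>" "sigma_functional \<Lambda>'" "concentrated_01 \<Lambda>" "concentrated_01 \<Lambda>'"
    and "\<And>n. \<Lambda> (\<lambda>t. indicator {0..1} t * t ^ n) = \<Lambda>' (\<lambda>t. indicator {0..1} t * t ^ n)"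
    and "bounded_borel \<phi>"
  shows "\<Lambda> \<phi> = \<Lambda>' \<phi>"
  using sf_zero_if_moments_zero[OF sigma_functional_diff[OF assms(1,2)] _ _ assms(6)] assms(3-5)
  by (auto simp: concentrated_01_def)

section \<open>The Hausdorff moment problem\<close>

text \<open>The ratio is the probability that \<open>m\<close> draws without replacement from
  \<open>n\<close> objects all hit the \<open>k\<close> marked ones; the power is the same with
  replacement. Both are products of \<open>m\<close> factors in [0,1], and corresponding factors
  differ by at most \<open>m / (n - m)\<close>.\<close>

lemma binomial_ratio_approx:
  assumes "k \<le> n" "m < n"
  shows "\<bar>real (k choose m) / real (n choose m) - (real k / real n) ^ m\<bar> \<le> (real m)\<^sup>2 / real (n - m)"
proof -
  let ?q = "\<lambda>i. real (k - i) / real (n - i)"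
  have ratio: "real (k choose m) / real (n choose m) = (\<Prod>i<m. ?q i)"
  proof (cases "m \<le> k")
    case True
    have prod: "real (a choose m) = (\<Prod>i<m. real (a - i)) / fact m" if "m \<le> a" for a
      using that by (simp add: binomial_gbinomial gbinomial_prod_rev of_nat_diff atLeast0LessThan)
    show ?thesis
      using assms True by (simp add: prod prod_dividef)
  next
    case False
    \<comment> \<open>Truncated subtraction makes the factor at \<open>i = k\<close> vanish, in
      agreement with \<open>k choose m = 0\<close>.\<close>
    then have "(\<Prod>i<m. ?q i) = 0" by (intro prod_zero) auto
    then show ?thesis using False by (simp add: binomial_eq_0)
  qed
  have diff: "\<bar>?q i - real k / real n\<bar> \<le> real m / real (n - m)" if "i < m" for i
  proof -
    have "real i / real (n - i) \<le> real m / real (n - m)"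
      using that assms by (intro frac_le) auto
    moreover have "\<bar>?q i - real k / real n\<bar> \<le> real i / real (n - i)"
    proof (cases "i \<le> k")
      case True
      have "real k / real n - ?q i = (real i * (real n - real k)) / (real n * real (n - i))"
        using that assms True by (simp add: of_nat_diff field_simps)
      also have "\<dots> = ((real n - real k) / real n) * (real i / real (n - i))"
        by simp
      finally have eq: "real k / real n - ?q i = ((real n - real k) / real n) * (real i / real (n - i))" .
      have "0 \<le> (real n - real k) / real n" "(real n - real k) / real n \<le> 1"
        using assms by auto
      then have "0 \<le> real k / real n - ?q i" "real k / real n - ?q i \<le> real i / real (n - i)"
        unfolding eq by (intro mult_nonneg_nonneg mult_left_le_one_le; simp)+
      then show ?thesis by linarith
    next
      case False
      then have "real k / real n \<le> real i / real (n - i)"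
        using that assms by (intro frac_le) auto
      then show ?thesis using False by simp
    qed
    ultimately show ?thesis by linarith
  qed
  have "\<bar>(\<Prod>i<m. ?q i) - (\<Prod>i<m. real k / real n)\<bar> \<le> (\<Sum>i<m. \<bar>?q i - real k / real n\<bar>)"
  proof -
    have "?q i \<le> 1" if "i < m" for i using assms that by (auto simp: divide_le_eq_1)
    moreover have "real k / real n \<le> 1" using assms by auto
    ultimately show ?thesis
      using norm_prod_diff[of "{..<m}" ?q "\<lambda>_. real k / real n"] by simp
  qed
  also have "\<dots> \<le> (\<Sum>i<m. real m / real (n - m))" by (intro sum_mono diff) auto
  finally show ?thesis unfolding ratio by (simp add: power2_eq_square)
qed

text \<open>\<open>W k l\<close> plays the role of the integral of \<open>t\<^sup>k (1 - t)\<^sup>l\<close>. The measure is a weak limit of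
  discrete measures whose weights are the \<open>W\<close>-values of the Bernstein polynomials.\<close>

context
  fixes W :: "nat \<Rightarrow> nat \<Rightarrow> real"
  assumes W_nonneg: "\<And>k l. 0 \<le> W k l"
    and W_split: "\<And>k l. W k l = W (Suc k) l + W k (Suc l)"
begin

text \<open>Repeated splitting corresponds to multiplying the integrand by
  \<open>(t + (1 - t)) ^ r = 1\<close>.\<close>

lemma W_expand: "W k l = (\<Sum>j\<le>r. real (r choose j) * W (k + j) (l + r - j))"
proof (induction r arbitrary: k l)
  case (Suc r)
  have "W k l = (\<Sum>j\<le>r. real (r choose j) * W (Suc k + j) (l + r - j)) +
     (\<Sum>j\<le>r. real (r choose j) * W (k + j) (Suc l + r - j))"
    using W_split[of k l] Suc.IH by metis
  \<comment> \<open>The extra summand has the coefficient \<open>r choose Suc r = 0\<close>; the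
    longer range allows an index shift, after which Pascal's rule merges the two sums.\<close>
  also have "(\<Sum>j\<le>r. real (r choose j) * W (k + j) (Suc l + r - j)) =
      (\<Sum>j\<le>Suc r. real (r choose j) * W (k + j) (Suc l + r - j))" by simp
  also have "\<dots> = W k (Suc l + r) + (\<Sum>j\<le>r. real (r choose Suc j) * W (k + Suc j) (l + r - j))"
    by (subst sum.atMost_Suc_shift) simp
  finally have "W k l = W k (Suc l + r) + (\<Sum>j\<le>r. real (Suc r choose Suc j) * W (k + Suc j) (l + r - j))"
    by (simp add: sum.distrib algebra_simps)
  also have "\<dots> = (\<Sum>j\<le>Suc r. real (Suc r choose j) * W (k + j) (l + Suc r - j))"
    by (subst sum.atMost_Suc_shift) simp
  finally show ?case .
qed simp

text \<open>Expand \<open>W m 0\<close> with \<open>r = n - m\<close> and put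
  \<open>k = m + j\<close>. The identity for \<open>(n choose k) * (k choose m)\<close> turns the
  coefficients into Bernstein weights times \<open>(k choose m) / (n choose m)\<close>, which is
  close to \<open>(k / n) ^ m\<close>. For \<open>m = 0\<close> it says that the weights add up to
  \<open>W 0 0\<close>.\<close>

lemma W_moment:
  assumes "m \<le> n"
  shows "W m 0 = (\<Sum>k\<le>n. real (k choose m) / real (n choose m) * (real (n choose k) * W k (n - k)))"
proof -
  have "(\<Sum>k\<le>n. real (k choose m) / real (n choose m) * (real (n choose k) * W k (n - k))) =
     (\<Sum>k\<in>{m..n}. real (k choose m) / real (n choose m) * (real (n choose k) * W k (n - k)))"
    by (rule sum.mono_neutral_right) (auto simp: binomial_eq_0)
  also have "\<dots> = (\<Sum>k\<in>{m..n}. real ((n - m) choose (k - m)) * W k (n - k))"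
  proof (rule sum.cong[OF refl])
    fix k assume "k \<in> {m..n}"
    then have "real (n choose k) * real (k choose m) = real (n choose m) * real ((n - m) choose (k - m))"
      using choose_mult[of m k n] by (metis atLeastAtMost_iff of_nat_mult)
    then have "real (k choose m) / real (n choose m) * real (n choose k) = real ((n - m) choose (k - m))"
      using assms by (simp add: field_simps)
    then show "real (k choose m) / real (n choose m) * (real (n choose k) * W k (n - k)) =
      real ((n - m) choose (k - m)) * W k (n - k)" by (metis mult.assoc)
  qed
  also have "\<dots> = (\<Sum>j\<le>n - m. real ((n - m) choose j) * W (m + j) (0 + (n - m) - j))"
    by (rule sum.reindex_bij_witness[of _ "\<lambda>j. m + j" "\<lambda>k. k - m"]) (use assms in auto)
  also have "\<dots> = W m 0" by (rule W_expand[symmetric])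
  finally show ?thesis by simp
qed

text \<open>The atom of weight \<open>w n k\<close> sits at \<open>k / n\<close>. Tightness holds
  because all atoms lie in [0,1]; the \<open>m\<close>-th moments converge because
  \<open>W_moment\<close> and \<open>binomial_ratio_approx\<close> bound their distance from
  \<open>W m 0\<close> by a term of order \<open>1/n\<close>.\<close>

lemma hausdorff_moment_probability:
  assumes one: "W 0 0 = 1"
  obtains M where "real_distribution M" "AE t in M. t \<in> {0..1}" "\<And>n. integral\<^sup>L M (\<lambda>t. t ^ n) = W n 0"
proof -
  define w where "w n k = real (n choose k) * W k (n - k)" for n k
  have w_nonneg: "0 \<le> w n k" for n k by (simp add: w_def W_nonneg)
  have w_sum: "(\<Sum>k\<le>n. w n k) = 1" for n
    using W_moment[of 0 n] one by (simp add: w_def)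
  define P where "P n = point_measure {..n} (\<lambda>k. ennreal (w n k))" for n
  define \<mu> where "\<mu> n = distr (P n) borel (\<lambda>k. real k / real n)" for n
  have meas[measurable]: "f \<in> measurable (P n) borel" for f :: "nat \<Rightarrow> real" and n
    by (simp add: P_def)
  have P: "prob_space (P n)" for n
  proof
    show "emeasure (P n) (space (P n)) = 1"
      by (simp add: P_def space_point_measure emeasure_point_measure_finite w_nonneg w_sum sum_ennreal)
  qed
  have \<mu>: "real_distribution (\<mu> n)" for n
    unfolding \<mu>_def by (rule prob_space.real_distribution_distr[OF P]) simp
  have int: "integral\<^sup>L (\<mu> n) f = (\<Sum>k\<le>n. w n k * f (real k / real n))" if "f \<in> borel_measurable borel" for n and f :: "real \<Rightarrow> real"
    unfolding \<mu>_def using that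
    by (simp add: integral_distr P_def lebesgue_integral_point_measure_finite w_nonneg)
  have "tight \<mu>"
    unfolding tight_def
  proof (intro conjI allI impI \<mu>)
    fix \<epsilon> :: real assume "0 < \<epsilon>"
    interpret real_distribution "\<mu> n" for n by (rule \<mu>)
    \<comment> \<open>Tightness is phrased with half-open intervals, so the left end is taken below
      0 to include the atom at 0. The case \<open>n = 0\<close> is covered too, since
      \<open>k / 0\<close> is 0.\<close>
    have "measure (\<mu> n) {-1<..1} = 1" for n
    proof -
      have "measure (\<mu> n) {-1<..1} = integral\<^sup>L (\<mu> n) (indicator {-1<..1})" by simp
      also have "\<dots> = (\<Sum>k\<le>n. w n k * indicator {-1<..1} (real k / real n))"
        by (rule int) simp
      also have "\<dots> = (\<Sum>k\<le>n. w n k)"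
        by (rule sum.cong) (auto simp: indicator_def divide_le_eq_1 less_le_trans[of "-1" 0])
      finally show ?thesis using w_sum by simp
    qed
    then show "\<exists>a b. a < b \<and> (\<forall>n. 1 - \<epsilon> < measure (\<mu> n) {a<..b})"
      using \<open>0 < \<epsilon>\<close> by (intro exI[of _ "-1"] exI[of _ 1]) auto
  qed
  from tight_imp_convergent_subsubsequence[OF this strict_mono_id]
  obtain r M where r: "strict_mono r" and M: "real_distribution M" and conv: "weak_conv_m (\<mu> \<circ> id \<circ> r) M"
    by blast
  interpret M: real_distribution M by fact
  have lim: "(\<lambda>n. integral\<^sup>L (\<mu> (r n)) f) \<longlonglongrightarrow> integral\<^sup>L M f"
    if "continuous_on UNIV f" "\<And>t. \<bar>f t\<bar> \<le> 1" for f :: "real \<Rightarrow> real"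
    using weak_conv_imp_integral_bdd_continuous_conv[OF _ M conv, of f 1] \<mu> that
    by (simp add: continuous_on_eq_continuous_at)
  \<comment> \<open>The distance to [0,1], cut off at 1. It is bounded, continuous and zero exactly
    on [0,1], so weak convergence carries the support over to \<open>M\<close>.\<close>
  define d where "d t = min 1 (max 0 (max (- t) (t - 1)))" for t :: real
  have d_cont: "continuous_on UNIV d" unfolding d_def by (intro continuous_intros)
  then have d_meas: "d \<in> borel_measurable borel" by (rule borel_measurable_continuous_onI)
  have "integral\<^sup>L (\<mu> n) d = 0" for n
  proof -
    have "d (real k / real n) = 0" if "k \<le> n" for k
    proof -
      have "0 \<le> real k / real n" "real k / real n \<le> 1"
        using that by (auto simp: divide_le_eq_1)
      then show ?thesis unfolding d_def by linarith
    qed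
    then show ?thesis unfolding int[OF d_meas] by simp
  qed
  then have "integral\<^sup>L M d = 0"
    using lim[OF d_cont] by (auto simp: d_def LIMSEQ_const_iff)
  moreover have "integrable M d"
    using d_meas by (intro M.integrable_const_bound[where B=1]) (auto simp: d_def)
  ultimately have "AE t in M. d t = 0"
    by (subst (asm) integral_nonneg_eq_0_iff_AE) (auto simp: d_def)
  then have supp: "AE t in M. t \<in> {0..1}"
    by (rule AE_mp) (auto simp: d_def min_def max_def split: if_splits intro!: AE_I2)
  have "integral\<^sup>L M (\<lambda>t. t ^ m) = W m 0" for m
  proof -
    \<comment> \<open>Clamping \<open>t\<close> to [0,1] turns the unbounded \<open>t ^ m\<close>
      into a bounded continuous test function that agrees with it wherever the measures have
      mass.\<close>
    define c where "c t = (max 0 (min 1 t)) ^ m" for t :: real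
    have c_cont: "continuous_on UNIV c" unfolding c_def by (intro continuous_intros)
    then have c_meas: "c \<in> borel_measurable borel" by (rule borel_measurable_continuous_onI)
    have c_bound: "\<bar>c t\<bar> \<le> 1" for t by (auto simp: c_def power_le_one)
    have "\<bar>integral\<^sup>L (\<mu> n) c - W m 0\<bar> \<le> (real m)\<^sup>2 / real (n - m)" if "m < n" for n
    proof -
      have c_eq: "c (real k / real n) = (real k / real n) ^ m" if "k \<le> n" for k
      proof -
        have "0 \<le> real k / real n" "real k / real n \<le> 1"
          using that by (auto simp: divide_le_eq_1)
        then have "max 0 (min 1 (real k / real n)) = real k / real n" by linarith
        then show ?thesis by (simp only: c_def)
      qed
      have "integral\<^sup>L (\<mu> n) c - W m 0 =
         (\<Sum>k\<le>n. w n k * ((real k / real n) ^ m - real (k choose m) / real (n choose m)))"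
        unfolding int[OF c_meas] W_moment[OF less_imp_le[OF that]] w_def[symmetric] sum_subtractf[symmetric]
        by (rule sum.cong) (auto simp: c_eq algebra_simps)
      also have "\<bar>\<dots>\<bar> \<le> (\<Sum>k\<le>n. w n k * ((real m)\<^sup>2 / real (n - m)))"
      proof (rule order_trans[OF sum_abs], rule sum_mono)
        fix k assume "k \<in> {..n}"
        then show "\<bar>w n k * ((real k / real n) ^ m - real (k choose m) / real (n choose m))\<bar>
            \<le> w n k * ((real m)\<^sup>2 / real (n - m))"
          using binomial_ratio_approx[OF _ that, of k] unfolding abs_mult
          by (intro mult_mono) (auto simp: w_nonneg abs_minus_commute)
      qed
      also have "\<dots> = (real m)\<^sup>2 / real (n - m)"
        by (subst sum_distrib_right[symmetric]) (simp only: w_sum mult_1_left)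
      finally show ?thesis .
    qed
    moreover have "(\<lambda>n. (real m)\<^sup>2 / real (n - m)) \<longlonglongrightarrow> 0"
    proof (rule LIMSEQ_offset[of _ m])
      show "(\<lambda>n. (real m)\<^sup>2 / real (n + m - m)) \<longlonglongrightarrow> 0"
        unfolding add_diff_cancel_right' by (rule lim_const_over_n)
    qed
    ultimately have "(\<lambda>n. integral\<^sup>L (\<mu> n) c - W m 0) \<longlonglongrightarrow> 0"
      using Lim_null_comparison[OF eventually_sequentiallyI[of "Suc m"],
        of "\<lambda>n. integral\<^sup>L (\<mu> n) c - W m 0" "\<lambda>n. (real m)\<^sup>2 / real (n - m)"]
      unfolding real_norm_def Suc_le_eq by blast
    from LIMSEQ_subseq_LIMSEQ[OF LIM_zero_cancel[OF this] r]
    have "(\<lambda>n. integral\<^sup>L (\<mu> (r n)) c) \<longlonglongrightarrow> W m 0"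
      unfolding o_def .
    then have "integral\<^sup>L M c = W m 0"
      by (rule LIMSEQ_unique[OF lim[OF c_cont c_bound]])
    moreover have "integral\<^sup>L M c = integral\<^sup>L M (\<lambda>t. t ^ m)"
    proof (rule integral_cong_AE)
      show "AE t in M. c t = t ^ m"
        using supp by eventually_elim (simp add: c_def min_absorb2 max_absorb2)
    qed (use c_meas in simp_all)
    ultimately show ?thesis by simp
  qed
  with M supp that show ?thesis by blast
qed

end

text \<open>Division by the total mass \<open>W 0 0\<close> reduces to a probability. If the mass is
  0, then all moments are 0, because \<open>W n 0\<close> decreases in \<open>n\<close>, and the
  null measure serves.\<close>

theorem hausdorff_moments:
  fixes W :: "nat \<Rightarrow> nat \<Rightarrow> real"
  assumes nonneg: "\<And>k l. 0 \<le> W k l" and split: "\<And>k l. W k l = W (Suc k) l + W k (Suc l)"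
  obtains M where "finite_measure M" "sets M = sets borel" "AE t in M. t \<in> {0..1}"
    "\<And>n. integral\<^sup>L M (\<lambda>t. t ^ n) = W n 0"
proof (cases "W 0 0 = 0")
  case True
  have "W n 0 \<le> W 0 0" for n
  proof (induction n)
    case (Suc n)
    then show ?case using split[of n 0] nonneg[of n 1] by simp
  qed simp
  then have "W n 0 = 0" for n using nonneg[of n 0] True by (metis antisym)
  moreover have "finite_measure (null_measure borel :: real measure)"
    by (rule finite_measureI) simp
  moreover have "AE t in (null_measure borel :: real measure). t \<in> {0..1}"
    by (rule AE_I[where N=UNIV]) auto
  ultimately show ?thesis using that[of "null_measure borel"] by (simp add: integral_null_measure)
next
  case False
  define V where "V k l = W k l / W 0 0" for k l
  have pos: "0 < W 0 0" using False nonneg[of 0 0] by simp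
  have "V k l = V (Suc k) l + V k (Suc l)" for k l
    using split[of k l] by (simp add: V_def add_divide_distrib)
  moreover have "0 \<le> V k l" for k l using nonneg by (simp add: V_def)
  moreover have "V 0 0 = 1" using pos by (simp add: V_def)
  ultimately obtain M where M: "real_distribution M" "AE t in M. t \<in> {0..1}" "\<And>n. integral\<^sup>L M (\<lambda>t. t ^ n) = V n 0"
    using hausdorff_moment_probability[of V] by metis
  interpret real_distribution M by fact
  let ?N = "density M (\<lambda>_. ennreal (W 0 0))"
  show ?thesis
  proof
    show "finite_measure ?N"
      by (rule finite_measureI) (use emeasure_space_1 in \<open>simp add: emeasure_density\<close>)
    show "sets ?N = sets borel" by simp
    show "AE t in ?N. t \<in> {0..1}"
      using M(2) by (simp add: AE_density)
    show "integral\<^sup>L ?N (\<lambda>t. t ^ n) = W n 0" for n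
      using pos by (subst integral_density) (auto simp: M(3) V_def)
  qed
qed

section \<open>Polarized integrals\<close>

text \<open>This is \<open>spectral_form\<close> with an arbitrary family in place of the scalar
  measures of \<open>E\<close>, so that form and operator make sense for measures obtained from
  moments, before any projections exist.\<close>

definition polar_form ::
    "('a::complex_hilbert \<Rightarrow> real measure) \<Rightarrow> (real \<Rightarrow> real) \<Rightarrow> 'a \<Rightarrow> 'a \<Rightarrow> complex" where
  "polar_form \<mu> \<phi> x y =
     (\<Sum>k<4. \<i> ^ k * complex_of_real (integral\<^sup>L (\<mu> (x + (\<i> ^ k) *\<^sub>C y)) \<phi>)) / 4"

definition square_integrable_vectors ::
    "('a::complex_hilbert \<Rightarrow> real measure) \<Rightarrow> (real \<Rightarrow> real) \<Rightarrow> 'a set" where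
  "square_integrable_vectors \<mu> \<phi> = {x. integrable (\<mu> x) (\<lambda>t. (\<phi> t)\<^sup>2)}"

definition polar_operator ::
    "('a::complex_hilbert \<Rightarrow> real measure) \<Rightarrow> (real \<Rightarrow> real) \<Rightarrow> 'a operator_graph" where
  "polar_operator \<mu> \<phi> = {(x, y). x \<in> square_integrable_vectors \<mu> \<phi> \<and>
     (\<forall>z \<in> square_integrable_vectors \<mu> \<phi>. cinner y z = polar_form \<mu> \<phi> x z)}"

lemma square_integrable_vectorsD:
  "x \<in> square_integrable_vectors \<mu> \<phi> \<Longrightarrow> integrable (\<mu> x) (\<lambda>t. (\<phi> t)\<^sup>2)"
  by (simp add: square_integrable_vectors_def)

lemma spectral_form_eq: "spectral_form E = polar_form (scalar_measure E)"
  by (intro ext) (simp add: spectral_form_def polar_form_def)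

lemma spectral_integral_eq: "spectral_integral E = polar_operator (scalar_measure E)"
  by (intro ext) (simp add: spectral_integral_def polar_operator_def spectral_domain_def
      square_integrable_vectors_def spectral_form_eq)

lemma sum_lessThan_4: "(\<Sum>k<4. f k) = f 0 + f 1 + f 2 + f (3::nat)"
  by (simp add: eval_nat_numeral add.assoc)

lemma i_cube: "\<i> ^ 3 = - \<i>"
  by (simp add: power3_eq_cube)

lemma polarization:
  assumes "bounded_clinear T"
  shows "(\<Sum>k<4. \<i> ^ k * cinner (T (x + (\<i> ^ k) *\<^sub>C y)) (x + (\<i> ^ k) *\<^sub>C y)) / 4 = cinner (T x) y"
proof -
  have add: "T (u + v) = T u + T v" and scale: "T (c *\<^sub>C u) = c *\<^sub>C T u" for u v c
    using assms by (auto simp: bounded_clinear_def linear_add bounded_linear.linear)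
  show ?thesis
    by (simp add: sum_lessThan_4 i_cube add scale cinner_add_left cinner_add_right cinner_scaleC_left
        cinner_scaleC_right algebra_simps)
qed

lemma sum_norm_polar: "(\<Sum>k<4. (norm (x + (\<i> ^ k) *\<^sub>C y))\<^sup>2) = 4 * ((norm x)\<^sup>2 + (norm y)\<^sup>2)"
  for x :: "'a::complex_hilbert"
proof -
  have "(norm (x + \<i> *\<^sub>C y))\<^sup>2 + (norm (x - \<i> *\<^sub>C y))\<^sup>2 = 2 * (norm x)\<^sup>2 + 2 * (norm y)\<^sup>2"
    using parallelogram[of x "\<i> *\<^sub>C y"] by (simp add: norm_scaleC)
  moreover have "(- \<i>) *\<^sub>C y = - (\<i> *\<^sub>C y)"
    using scaleC_scaleC[of "-1" \<i> y] by simp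
  ultimately show ?thesis
    using parallelogram[of x y] by (simp add: sum_lessThan_4 i_cube)
qed

locale measure_family =
  fixes \<mu> :: "'a::complex_hilbert \<Rightarrow> real measure"
  assumes sets_\<mu>: "sets (\<mu> x) = sets borel"
    and emeasure_\<mu>: "emeasure (\<mu> x) UNIV = ennreal ((norm x)\<^sup>2)"
begin

lemma space_\<mu>: "space (\<mu> x) = UNIV"
  using sets_eq_imp_space_eq[OF sets_\<mu>] by simp

lemma finite_measure_\<mu>: "finite_measure (\<mu> x)"
  by (rule finite_measureI) (simp add: space_\<mu> emeasure_\<mu>)

lemma measurable_\<mu>: "\<phi> \<in> borel_measurable (\<mu> x) \<longleftrightarrow> \<phi> \<in> borel_measurable borel"
  for \<phi> :: "real \<Rightarrow> 'b::topological_space"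
  using measurable_cong_sets[OF sets_\<mu> refl] by auto

lemma measure_\<mu>: "measure (\<mu> x) UNIV = (norm x)\<^sup>2"
  by (simp add: measure_def emeasure_\<mu>)

lemma integral_indicator_\<mu>: "B \<in> sets borel \<Longrightarrow> integral\<^sup>L (\<mu> x) (indicator B) = measure (\<mu> x) B"
  by (simp add: sets_\<mu> space_\<mu>)

lemma integrable_bounded: "bounded_borel \<phi> \<Longrightarrow> integrable (\<mu> x) \<phi>"
proof -
  assume bb: "bounded_borel \<phi>"
  obtain C where C: "\<And>t. \<bar>\<phi> t\<bar> \<le> C" using bb by (auto simp: bounded_borel_def)
  show ?thesis
    by (rule finite_measure.integrable_const_bound[OF finite_measure_\<mu>, where B=C])
      (use C bounded_borel_measurable[OF bb] in \<open>auto simp: measurable_\<mu>\<close>)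
qed

lemma integrable_if_square_integrable:
  fixes \<phi> :: "real \<Rightarrow> real"
  assumes "\<phi> \<in> borel_measurable borel" "integrable (\<mu> x) (\<lambda>t. (\<phi> t)\<^sup>2)"
  shows "integrable (\<mu> x) \<phi>"
proof (rule Bochner_Integration.integrable_bound)
  show "integrable (\<mu> x) (\<lambda>t. 1 + (\<phi> t)\<^sup>2)"
    by (intro Bochner_Integration.integrable_add assms integrable_bounded bounded_borel_const)
  have "\<bar>\<phi> t\<bar> \<le> 1 + (\<phi> t)\<^sup>2" for t
  proof -
    have "0 \<le> (\<bar>\<phi> t\<bar> - 1)\<^sup>2 + \<bar>\<phi> t\<bar>" by (intro add_nonneg_nonneg) auto
    then show ?thesis by (simp add: power2_diff)
  qed
  then show "AE t in \<mu> x. norm (\<phi> t) \<le> norm (1 + (\<phi> t)\<^sup>2)"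
    by (intro AE_I2) (simp add: abs_of_nonneg add_nonneg_nonneg)
qed (use assms in \<open>simp add: measurable_\<mu>\<close>)

lemma abs_integral_le:
  assumes "\<phi> \<in> borel_measurable borel" "\<And>t. \<bar>\<phi> t\<bar> \<le> C"
  shows "\<bar>integral\<^sup>L (\<mu> x) \<phi>\<bar> \<le> C * (norm x)\<^sup>2"
proof -
  have bb: "bounded_borel \<phi>" using assms by (rule bounded_borelI)
  have "\<bar>integral\<^sup>L (\<mu> x) \<phi>\<bar> \<le> integral\<^sup>L (\<mu> x) (\<lambda>t. \<bar>\<phi> t\<bar>)"
    by (rule integral_abs_bound)
  also have "\<dots> \<le> integral\<^sup>L (\<mu> x) (\<lambda>t. C)"
    by (rule integral_mono) (use assms bb in \<open>auto intro: integrable_bounded bounded_borel_const integrable_abs\<close>)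
  also have "\<dots> = C * (norm x)\<^sup>2" by (simp add: space_\<mu> measure_\<mu>)
  finally show ?thesis .
qed

lemma sigma_functional_integral_\<mu>: "sigma_functional (\<lambda>\<phi>. complex_of_real (integral\<^sup>L (\<mu> x) \<phi>))"
  by (rule sigma_functional_integral[OF finite_measure_\<mu> sets_\<mu>])

lemma sigma_functional_polar_form: "sigma_functional (\<lambda>\<phi>. polar_form \<mu> \<phi> x y)"
proof -
  have "polar_form \<mu> \<phi> x y = 1 / 4 * (
      (1 * complex_of_real (integral\<^sup>L (\<mu> (x + y)) \<phi>)
       + \<i> * complex_of_real (integral\<^sup>L (\<mu> (x + \<i> *\<^sub>C y)) \<phi>))
       + (- 1 * complex_of_real (integral\<^sup>L (\<mu> (x + (- 1) *\<^sub>C y)) \<phi>)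
       + - \<i> * complex_of_real (integral\<^sup>L (\<mu> (x + (- \<i>) *\<^sub>C y)) \<phi>)))" for \<phi>
    unfolding polar_form_def sum_lessThan_4 by (simp add: i_cube)
  then show ?thesis
    by (simp only:) (intro sigma_functional_scale sigma_functional_add sigma_functional_integral_\<mu>)
qed

lemma polar_form_le:
  assumes "\<phi> \<in> borel_measurable borel" "\<And>t. \<bar>\<phi> t\<bar> \<le> C"
  shows "cmod (polar_form \<mu> \<phi> x y) \<le> C * ((norm x)\<^sup>2 + (norm y)\<^sup>2)"
proof -
  have "cmod (polar_form \<mu> \<phi> x y) \<le> (\<Sum>k<4. cmod (\<i> ^ k * complex_of_real (integral\<^sup>L (\<mu> (x + (\<i> ^ k) *\<^sub>C y)) \<phi>))) / 4"
    unfolding polar_form_def norm_divide by (simp add: norm_sum)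
  also have "\<dots> \<le> (\<Sum>k<4. C * (norm (x + (\<i> ^ k) *\<^sub>C y))\<^sup>2) / 4"
    by (intro divide_right_mono sum_mono)
      (use abs_integral_le[OF assms] in \<open>auto simp: norm_mult norm_power\<close>)
  also have "\<dots> = C * ((norm x)\<^sup>2 + (norm y)\<^sup>2)"
    by (simp add: sum_distrib_left[symmetric] sum_norm_polar)
  finally show ?thesis .
qed

text \<open>Functional identities are available for bounded functions; cutting \<open>\<phi>\<close>
  off where it exceeds \<open>n\<close> transfers them to unbounded ones by dominated
  convergence.\<close>

lemma integral_truncation_tendsto:
  assumes "integrable (\<mu> x) \<phi>" "\<phi> \<in> borel_measurable borel"
  shows "(\<lambda>n. integral\<^sup>L (\<mu> x) (\<lambda>t. indicator {t. \<bar>\<phi> t\<bar> \<le> real n} t * \<phi> t)) \<longlonglongrightarrow> integral\<^sup>L (\<mu> x) \<phi>"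
proof (rule integral_dominated_convergence[where w="\<lambda>t. \<bar>\<phi> t\<bar>"])
  have "(\<lambda>n. indicator {t. \<bar>\<phi> t\<bar> \<le> real n} t * \<phi> t) \<longlonglongrightarrow> \<phi> t" for t
  proof (rule tendsto_eventually, rule eventually_sequentiallyI)
    fix n assume "nat \<lceil>\<bar>\<phi> t\<bar>\<rceil> \<le> n"
    then have "\<bar>\<phi> t\<bar> \<le> real n" by linarith
    then show "indicator {t. \<bar>\<phi> t\<bar> \<le> real n} t * \<phi> t = \<phi> t" by simp
  qed
  then show "AE t in \<mu> x. (\<lambda>n. indicator {t. \<bar>\<phi> t\<bar> \<le> real n} t * \<phi> t) \<longlonglongrightarrow> \<phi> t" by simp
  show "(\<lambda>t. indicator {t. \<bar>\<phi> t\<bar> \<le> real n} t * \<phi> t) \<in> borel_measurable (\<mu> x)" for n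
    unfolding measurable_\<mu> using assms(2) by measurable
qed (use assms in \<open>auto simp: indicator_def measurable_\<mu>\<close>)

lemma bounded_borel_truncation:
  assumes "\<phi> \<in> borel_measurable borel"
  shows "bounded_borel (\<lambda>t. indicator {t. \<bar>\<phi> t\<bar> \<le> real n} t * \<phi> t)"
  by (rule bounded_borel_indicator_mult[where C="real n"]) (use assms in measurable)

lemma polar_form_truncation_tendsto:
  assumes "\<And>k. k < 4 \<Longrightarrow> integrable (\<mu> (x + (\<i> ^ k) *\<^sub>C y)) \<phi>" "\<phi> \<in> borel_measurable borel"
  shows "(\<lambda>n. polar_form \<mu> (\<lambda>t. indicator {t. \<bar>\<phi> t\<bar> \<le> real n} t * \<phi> t) x y) \<longlonglongrightarrow> polar_form \<mu> \<phi> x y"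
  unfolding polar_form_def
  by (intro tendsto_divide tendsto_sum tendsto_mult tendsto_of_real tendsto_const
      integral_truncation_tendsto assms) auto

end

text \<open>A family of measures which is quadratic in the vector, like \<open>B \<mapsto> \<langle>E(B) x, x\<rangle>\<close>.\<close>

locale spectral_family = measure_family +
  assumes form_add: "bounded_borel \<phi> \<Longrightarrow> polar_form \<mu> \<phi> (x + x') y = polar_form \<mu> \<phi> x y + polar_form \<mu> \<phi> x' y"
    and form_scale: "bounded_borel \<phi> \<Longrightarrow> polar_form \<mu> \<phi> (c *\<^sub>C x) y = c * polar_form \<mu> \<phi> x y"
    and form_herm: "bounded_borel \<phi> \<Longrightarrow> polar_form \<mu> \<phi> y x = cnj (polar_form \<mu> \<phi> x y)"
    and form_diag: "bounded_borel \<phi> \<Longrightarrow> polar_form \<mu> \<phi> x x = complex_of_real (integral\<^sup>L (\<mu> x) \<phi>)"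
begin

lemma form_add_right:
  assumes "bounded_borel \<phi>"
  shows "polar_form \<mu> \<phi> x (y + y') = polar_form \<mu> \<phi> x y + polar_form \<mu> \<phi> x y'"
proof -
  have "cnj (polar_form \<mu> \<phi> (y + y') x) = cnj (polar_form \<mu> \<phi> y x) + cnj (polar_form \<mu> \<phi> y' x)"
    by (simp add: form_add[OF assms])
  then show ?thesis by (simp only: form_herm[OF assms, of x, symmetric])
qed

lemma form_scale_right:
  assumes "bounded_borel \<phi>"
  shows "polar_form \<mu> \<phi> x (c *\<^sub>C y) = cnj c * polar_form \<mu> \<phi> x y"
proof -
  have "cnj (polar_form \<mu> \<phi> (c *\<^sub>C y) x) = cnj c * cnj (polar_form \<mu> \<phi> y x)"
    by (simp add: form_scale[OF assms])
  then show ?thesis by (simp only: form_herm[OF assms, of x, symmetric])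
qed

text \<open>The bound \<open>polar_form_le\<close> is not homogeneous. Scaling both vectors to norm
  1 turns its sum of squares into a product of norms, at the price of the factor 2.\<close>

lemma form_bound:
  assumes bb: "bounded_borel \<phi>" and C: "\<And>t. \<bar>\<phi> t\<bar> \<le> C"
  shows "cmod (polar_form \<mu> \<phi> x y) \<le> (2 * C) * norm x * norm y"
proof (cases "x = 0 \<or> y = 0")
  case True
  then show ?thesis
    using form_scale[OF bb, of 0 0] form_scale_right[OF bb, of _ 0 0] by auto
next
  case False
  define u v where "u = complex_of_real (inverse (norm x)) *\<^sub>C x"
    and "v = complex_of_real (inverse (norm y)) *\<^sub>C y"
  have x: "x = complex_of_real (norm x) *\<^sub>C u" and y: "y = complex_of_real (norm y) *\<^sub>C v"
    unfolding u_def v_def scaleC_scaleC of_real_mult[symmetric] using False by simp_all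
  have "polar_form \<mu> \<phi> x y = complex_of_real (norm x * norm y) * polar_form \<mu> \<phi> u v"
    by (subst x, subst y) (simp only: form_scale[OF bb] form_scale_right[OF bb] complex_cnj_complex_of_real
        of_real_mult mult.assoc mult.left_commute)
  moreover have "cmod (polar_form \<mu> \<phi> u v) \<le> C * ((norm u)\<^sup>2 + (norm v)\<^sup>2)"
    using bb C by (intro polar_form_le bounded_borel_measurable)
  moreover have "norm u = 1" "norm v = 1" using False by (auto simp: u_def v_def norm_scaleC norm_inverse)
  ultimately have "cmod (polar_form \<mu> \<phi> x y) \<le> (norm x * norm y) * (2 * C)"
    by (simp add: norm_mult mult_left_mono)
  then show ?thesis by (simp add: mult_ac)
qed

lemma operator_of_function:
  assumes bb: "bounded_borel \<phi>"
  obtains T where "bounded_clinear T" "\<And>x y. cinner (T x) y = polar_form \<mu> \<phi> x y"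
proof -
  obtain C where C: "\<And>t. \<bar>\<phi> t\<bar> \<le> C" using bb by (auto simp: bounded_borel_def)
  show ?thesis
  proof (rule operator_of_form[of "polar_form \<mu> \<phi>" "polar_form \<mu> \<phi>" "2 * C"])
    show "cmod (polar_form \<mu> \<phi> x y) \<le> 2 * C * norm x * norm y" for x y
      by (rule form_bound[OF bb C])
  qed (fact form_add[OF bb] form_scale[OF bb] form_herm[OF bb] that)+
qed

lemma integral_scale:
  assumes bb: "bounded_borel \<phi>"
  shows "integral\<^sup>L (\<mu> (c *\<^sub>C x)) \<phi> = (cmod c)\<^sup>2 * integral\<^sup>L (\<mu> x) \<phi>"
proof -
  have "complex_of_real (integral\<^sup>L (\<mu> (c *\<^sub>C x)) \<phi>) = c * cnj c * complex_of_real (integral\<^sup>L (\<mu> x) \<phi>)"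
    by (simp flip: form_diag[OF bb] add: form_scale[OF bb] form_scale_right[OF bb])
  then have "complex_of_real (integral\<^sup>L (\<mu> (c *\<^sub>C x)) \<phi>) = complex_of_real ((cmod c)\<^sup>2 * integral\<^sup>L (\<mu> x) \<phi>)"
    by (simp add: mult_cnj_norm)
  then show ?thesis using of_real_eq_iff by blast
qed

text \<open>The parallelogram law for the quadratic form given by \<open>\<phi>\<close>, with the
  term for \<open>x - y\<close> dropped. It makes the square-integrable vectors closed under
  addition.\<close>

lemma integral_add_le:
  assumes bb: "bounded_borel \<phi>" and nonneg: "\<And>t. 0 \<le> \<phi> t"
  shows "integral\<^sup>L (\<mu> (x + y)) \<phi> \<le> 2 * integral\<^sup>L (\<mu> x) \<phi> + 2 * integral\<^sup>L (\<mu> y) \<phi>"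
proof -
  have "complex_of_real (integral\<^sup>L (\<mu> (x + y)) \<phi> + integral\<^sup>L (\<mu> (x + (-1) *\<^sub>C y)) \<phi>) =
      complex_of_real (2 * integral\<^sup>L (\<mu> x) \<phi> + 2 * integral\<^sup>L (\<mu> y) \<phi>)"
    unfolding of_real_add of_real_mult form_diag[OF bb, symmetric]
    by (simp only: form_add[OF bb] form_add_right[OF bb] form_scale[OF bb] form_scale_right[OF bb]) simp
  then have "integral\<^sup>L (\<mu> (x + y)) \<phi> + integral\<^sup>L (\<mu> (x + (-1) *\<^sub>C y)) \<phi> =
      2 * integral\<^sup>L (\<mu> x) \<phi> + 2 * integral\<^sup>L (\<mu> y) \<phi>"
    using of_real_eq_iff by blast
  moreover have "0 \<le> integral\<^sup>L (\<mu> (x + (-1) *\<^sub>C y)) \<phi>" using nonneg by simp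
  ultimately show ?thesis by linarith
qed

lemma bounded_borel_min:
  assumes "\<phi> \<in> borel_measurable borel" "\<And>t. 0 \<le> \<phi> t"
  shows "bounded_borel (\<lambda>t. min (\<phi> t) (real n))"
proof (rule bounded_borelI[where C="real n"])
  show "\<bar>min (\<phi> t) (real n)\<bar> \<le> real n" for t
    using assms(2)[of t] by linarith
  show "(\<lambda>t. min (\<phi> t) (real n)) \<in> borel_measurable borel"
    using assms(1) by measurable
qed

text \<open>Monotone convergence. Quadratic identities hold for bounded functions, so finiteness for
  an unbounded \<open>\<phi>\<close> is obtained from a uniform bound on its truncations.\<close>

lemma integrable_if_dominated:
  assumes "\<phi> \<in> borel_measurable borel" "\<And>t. 0 \<le> \<phi> t"
    and K: "\<And>n. integral\<^sup>L (\<mu> x) (\<lambda>t. min (\<phi> t) (real n)) \<le> K"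
  shows "integrable (\<mu> x) \<phi>"
proof -
  let ?f = "\<lambda>n t. min (\<phi> t) (real n)"
  have bb: "bounded_borel (?f n)" for n
    by (rule bounded_borel_min[OF assms(1,2)])
  have mono: "incseq (\<lambda>n. integral\<^sup>L (\<mu> x) (?f n))"
    by (rule incseq_SucI, rule integral_mono[OF integrable_bounded[OF bb] integrable_bounded[OF bb]]) simp
  obtain l where "(\<lambda>n. integral\<^sup>L (\<mu> x) (?f n)) \<longlonglongrightarrow> l"
    using incseq_convergent[OF mono, of K] K by metis
  then show ?thesis
  proof (rule integrable_monotone_convergence[rotated 3])
    have "(\<lambda>n. ?f n t) \<longlonglongrightarrow> \<phi> t" for t
    proof (rule tendsto_eventually, rule eventually_sequentiallyI)
      fix n assume "nat \<lceil>\<phi> t\<rceil> \<le> n"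
      then show "?f n t = \<phi> t" by linarith
    qed
    then show "AE t in \<mu> x. (\<lambda>n. ?f n t) \<longlonglongrightarrow> \<phi> t" by simp
    show "AE t in \<mu> x. mono (\<lambda>n. ?f n t)" by (auto simp: mono_def)
  qed (use assms integrable_bounded bb in \<open>auto simp: measurable_\<mu>\<close>)
qed

section \<open>Unbounded functions: domain, Hermitian form and quadratic form\<close>

context
  fixes \<phi> :: "real \<Rightarrow> real"
  assumes meas: "\<phi> \<in> borel_measurable borel"
begin

lemma square_integrable_vectors_add:
  assumes "x \<in> square_integrable_vectors \<mu> \<phi>" "y \<in> square_integrable_vectors \<mu> \<phi>"
  shows "x + y \<in> square_integrable_vectors \<mu> \<phi>"
proof -
  let ?f = "\<lambda>n t. min ((\<phi> t)\<^sup>2) (real n)"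
  have bb: "bounded_borel (?f n)" for n
    by (rule bounded_borel_min[OF borel_measurable_power[OF meas] zero_le_power2])
  have le: "integral\<^sup>L (\<mu> z) (?f n) \<le> integral\<^sup>L (\<mu> z) (\<lambda>t. (\<phi> t)\<^sup>2)"
    if "z \<in> square_integrable_vectors \<mu> \<phi>" for z n
    by (intro integral_mono[OF integrable_bounded[OF bb]] square_integrable_vectorsD[OF that]) simp
  have "integral\<^sup>L (\<mu> (x + y)) (?f n) \<le>
      2 * integral\<^sup>L (\<mu> x) (\<lambda>t. (\<phi> t)\<^sup>2) + 2 * integral\<^sup>L (\<mu> y) (\<lambda>t. (\<phi> t)\<^sup>2)" for n
    using integral_add_le[OF bb, of n x y] le[OF assms(1), of n] le[OF assms(2), of n] by simp
  from integrable_if_dominated[OF borel_measurable_power[OF meas] zero_le_power2 this] show ?thesis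
    unfolding square_integrable_vectors_def mem_Collect_eq .
qed

lemma square_integrable_vectors_scale:
  assumes "x \<in> square_integrable_vectors \<mu> \<phi>"
  shows "c *\<^sub>C x \<in> square_integrable_vectors \<mu> \<phi>"
proof -
  let ?f = "\<lambda>n t. min ((\<phi> t)\<^sup>2) (real n)"
  have bb: "bounded_borel (?f n)" for n
    by (rule bounded_borel_min[OF borel_measurable_power[OF meas] zero_le_power2])
  have "integral\<^sup>L (\<mu> (c *\<^sub>C x)) (?f n) \<le> (cmod c)\<^sup>2 * integral\<^sup>L (\<mu> x) (\<lambda>t. (\<phi> t)\<^sup>2)" for n
    unfolding integral_scale[OF bb]
    by (intro mult_left_mono integral_mono[OF integrable_bounded[OF bb]] square_integrable_vectorsD[OF assms]) simp_all
  from integrable_if_dominated[OF borel_measurable_power[OF meas] zero_le_power2 this] show ?thesis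
    unfolding square_integrable_vectors_def mem_Collect_eq .
qed

lemma integrable_polar:
  assumes "x \<in> square_integrable_vectors \<mu> \<phi>" "y \<in> square_integrable_vectors \<mu> \<phi>"
  shows "integrable (\<mu> (x + c *\<^sub>C y)) \<phi>"
  by (rule integrable_if_square_integrable[OF meas square_integrable_vectorsD])
    (rule square_integrable_vectors_add[OF assms(1) square_integrable_vectors_scale[OF assms(2)]])

lemma polar_form_herm:
  assumes "x \<in> square_integrable_vectors \<mu> \<phi>" "y \<in> square_integrable_vectors \<mu> \<phi>"
  shows "polar_form \<mu> \<phi> y x = cnj (polar_form \<mu> \<phi> x y)"
proof (rule LIMSEQ_unique)
  let ?f = "\<lambda>n t. indicator {t. \<bar>\<phi> t\<bar> \<le> real n} t * \<phi> t"
  show "(\<lambda>n. polar_form \<mu> (?f n) y x) \<longlonglongrightarrow> polar_form \<mu> \<phi> y x"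
    by (rule polar_form_truncation_tendsto[OF integrable_polar[OF assms(2,1)] meas])
  have "(\<lambda>n. cnj (polar_form \<mu> (?f n) x y)) \<longlonglongrightarrow> cnj (polar_form \<mu> \<phi> x y)"
    by (rule tendsto_cnj[OF polar_form_truncation_tendsto[OF integrable_polar[OF assms] meas]])
  then show "(\<lambda>n. polar_form \<mu> (?f n) y x) \<longlonglongrightarrow> cnj (polar_form \<mu> \<phi> x y)"
    unfolding form_herm[OF bounded_borel_truncation[OF meas], where y=y and x=x] .
qed

lemma polar_form_diag:
  assumes x: "x \<in> square_integrable_vectors \<mu> \<phi>"
  shows "polar_form \<mu> \<phi> x x = complex_of_real (integral\<^sup>L (\<mu> x) \<phi>)"
proof (rule LIMSEQ_unique)
  let ?f = "\<lambda>n t. indicator {t. \<bar>\<phi> t\<bar> \<le> real n} t * \<phi> t"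
  show "(\<lambda>n. polar_form \<mu> (?f n) x x) \<longlonglongrightarrow> polar_form \<mu> \<phi> x x"
    by (rule polar_form_truncation_tendsto[OF integrable_polar[OF x x] meas])
  have "integrable (\<mu> x) \<phi>" using integrable_polar[OF x x, of 0] by simp
  then have "(\<lambda>n. complex_of_real (integral\<^sup>L (\<mu> x) (?f n))) \<longlonglongrightarrow> complex_of_real (integral\<^sup>L (\<mu> x) \<phi>)"
    by (rule tendsto_of_real[OF integral_truncation_tendsto[OF _ meas]])
  then show "(\<lambda>n. polar_form \<mu> (?f n) x x) \<longlonglongrightarrow> complex_of_real (integral\<^sup>L (\<mu> x) \<phi>)"
    unfolding form_diag[OF bounded_borel_truncation[OF meas]] .
qed

lemma polar_operator_symmetric:
  assumes "(x, y) \<in> polar_operator \<mu> \<phi>" "(u, v) \<in> polar_operator \<mu> \<phi>"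
  shows "cinner y u = cinner x v"
proof -
  have x: "x \<in> square_integrable_vectors \<mu> \<phi>" and u: "u \<in> square_integrable_vectors \<mu> \<phi>"
    and "cinner y u = polar_form \<mu> \<phi> x u" "cinner v x = polar_form \<mu> \<phi> u x"
    using assms by (simp_all add: polar_operator_def)
  then have "cinner y u = cnj (cinner v x)" by (simp only: polar_form_herm[OF u x])
  then show ?thesis by (simp only: cinner_commute[of x v])
qed

lemma polar_operator_quadratic_form:
  assumes "(x, y) \<in> polar_operator \<mu> \<phi>"
  shows "cinner y x = complex_of_real (integral\<^sup>L (\<mu> x) \<phi>)"
  using assms polar_form_diag by (auto simp: polar_operator_def)

end

end

section \<open>Projection-valued measures\<close>

locale pvm =
  fixes E :: "real set \<Rightarrow> 'a::complex_hilbert \<Rightarrow> 'a"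
  assumes pvm: "projection_valued_measure E"
begin

lemma
  assumes "B \<in> sets borel"
  shows bounded_clinear_E: "bounded_clinear (E B)"
    and E_idem: "E B (E B x) = E B x"
    and E_sym: "cinner (E B x) y = cinner x (E B y)"
proof -
  have "orthogonal_projection (E B)"
    using pvm assms by (simp add: projection_valued_measure_def)
  then show "bounded_clinear (E B)" "E B (E B x) = E B x" "cinner (E B x) y = cinner x (E B y)"
    by (simp_all add: orthogonal_projection_def fun_eq_iff)
qed

lemma E_UNIV: "E UNIV x = x"
  using pvm by (simp add: projection_valued_measure_def)

lemma E_sums:
  assumes "\<And>n. B n \<in> sets borel" "disjoint_family B"
  shows "(\<lambda>n. E (B n) x) sums E (\<Union>n. B n) x"
proof -
  have "range B \<subseteq> sets borel" using assms(1) by blast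
  then show ?thesis using pvm assms(2) unfolding projection_valued_measure_def by blast
qed

lemma E_quadratic:
  assumes "B \<in> sets borel"
  shows "cinner (E B x) x = complex_of_real ((norm (E B x))\<^sup>2)"
proof -
  have "cinner (E B x) x = cinner (E B (E B x)) x" by (simp only: E_idem[OF assms])
  also have "\<dots> = cinner (E B x) (E B x)" by (rule E_sym[OF assms])
  finally show ?thesis by (simp only: cinner_self)
qed

lemma Re_E_quadratic: "B \<in> sets borel \<Longrightarrow> Re (cinner (E B x) x) = (norm (E B x))\<^sup>2"
  unfolding E_quadratic by (rule Re_complex_of_real)

lemma E_empty: "E {} x = 0"
proof -
  have "(\<lambda>n::nat. E {} x) sums E {} x"
    using E_sums[of "\<lambda>_. {}" x] by (simp add: disjoint_family_on_def)
  then show ?thesis using summable_const_iff sums_summable by blast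
qed

lemma sets_scalar_measure: "sets (scalar_measure E x) = sets borel"
proof -
  have "sets (scalar_measure E x) = sigma_sets UNIV (sets borel)"
    unfolding scalar_measure_def by (rule sets_measure_of) simp
  then show ?thesis using sets.sigma_sets_eq[of "borel :: real measure"] by simp
qed

lemma emeasure_scalar_measure:
  assumes B: "B \<in> sets borel"
  shows "emeasure (scalar_measure E x) B = ennreal ((norm (E B x))\<^sup>2)"
proof -
  have "emeasure (scalar_measure E x) B = ennreal (Re (cinner (E B x) x))"
  proof (rule emeasure_measure_of[OF scalar_measure_def])
    show "B \<in> sets (scalar_measure E x)" using B by (simp add: sets_scalar_measure)
    show "positive (sets (scalar_measure E x)) (\<lambda>B. ennreal (Re (cinner (E B x) x)))"
      by (simp add: positive_def E_empty)
    show "countably_additive (sets (scalar_measure E x)) (\<lambda>B. ennreal (Re (cinner (E B x) x)))"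
    proof (rule countably_additiveI)
      fix A :: "nat \<Rightarrow> real set"
      assume "range A \<subseteq> sets (scalar_measure E x)" and disj: "disjoint_family A"
      then have A: "A n \<in> sets borel" for n by (auto simp: sets_scalar_measure)
      have "(\<lambda>n. Re (cinner (E (A n) x) x)) sums Re (cinner (E (\<Union>n. A n) x) x)"
        by (intro bounded_linear.sums[OF bounded_linear_Re]
            bounded_linear.sums[OF bounded_bilinear.bounded_linear_left[OF bounded_bilinear_cinner]]
            E_sums A disj)
      moreover have "0 \<le> Re (cinner (E (A n) x) x)" for n using A by (simp add: Re_E_quadratic)
      ultimately show "(\<Sum>n. ennreal (Re (cinner (E (A n) x) x))) = ennreal (Re (cinner (E (\<Union>n. A n) x) x))"
        by (subst suminf_ennreal2) (auto simp: sums_iff)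
    qed
  qed auto
  then show ?thesis using B by (simp only: Re_E_quadratic)
qed

lemma measure_scalar_measure:
  "B \<in> sets borel \<Longrightarrow> measure (scalar_measure E x) B = (norm (E B x))\<^sup>2"
  by (simp add: measure_def emeasure_scalar_measure)

sublocale measure_family "scalar_measure E"
  by unfold_locales (simp_all add: sets_scalar_measure emeasure_scalar_measure E_UNIV)

lemma polar_form_indicator:
  assumes B: "B \<in> sets borel"
  shows "polar_form (scalar_measure E) (indicator B) x y = cinner (E B x) y"
proof -
  have "polar_form (scalar_measure E) (indicator B) x y =
      (\<Sum>k<4. \<i> ^ k * cinner (E B (x + (\<i> ^ k) *\<^sub>C y)) (x + (\<i> ^ k) *\<^sub>C y)) / 4"
    unfolding polar_form_def integral_indicator_\<mu>[OF B] measure_scalar_measure[OF B] E_quadratic[OF B] ..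
  also have "\<dots> = cinner (E B x) y" by (rule polarization[OF bounded_clinear_E[OF B]])
  finally show ?thesis .
qed

text \<open>On indicators the form is \<open>cinner (E B x) y\<close>, for which the axioms are
  properties of projections; equality on indicators extends to bounded Borel functions.\<close>

sublocale spectral_family "scalar_measure E"
proof
  fix \<phi> :: "real \<Rightarrow> real" and x x' y :: 'a and c :: complex
  assume bb: "bounded_borel \<phi>"
  have clin: "E B (u + v) = E B u + E B v" "E B (c *\<^sub>C u) = c *\<^sub>C E B u" if "B \<in> sets borel" for B u v
    using bounded_clinear_E[OF that] by (auto simp: bounded_clinear_def linear_add bounded_linear.linear)
  show "polar_form (scalar_measure E) \<phi> (x + x') y =
      polar_form (scalar_measure E) \<phi> x y + polar_form (scalar_measure E) \<phi> x' y"
    by (rule sigma_functional_eqI[OF sigma_functional_polar_form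
        sigma_functional_add[OF sigma_functional_polar_form sigma_functional_polar_form] bb])
      (simp add: polar_form_indicator clin cinner_add_left)
  show "polar_form (scalar_measure E) \<phi> (c *\<^sub>C x) y = c * polar_form (scalar_measure E) \<phi> x y"
    by (rule sigma_functional_eqI[OF sigma_functional_polar_form
        sigma_functional_scale[OF sigma_functional_polar_form] bb])
      (simp add: polar_form_indicator clin cinner_scaleC_left)
  show "polar_form (scalar_measure E) \<phi> y x = cnj (polar_form (scalar_measure E) \<phi> x y)"
  proof (rule sigma_functional_eqI[OF sigma_functional_polar_form
        sigma_functional_cnj[OF sigma_functional_polar_form] bb])
    fix B :: "real set" assume B: "B \<in> sets borel"
    show "polar_form (scalar_measure E) (indicator B) y x = cnj (polar_form (scalar_measure E) (indicator B) x y)"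
      unfolding polar_form_indicator[OF B] E_sym[OF B, of y] by (rule cinner_commute)
  qed
  show "polar_form (scalar_measure E) \<phi> x x = complex_of_real (integral\<^sup>L (scalar_measure E x) \<phi>)"
  proof (rule sigma_functional_eqI[OF sigma_functional_polar_form sigma_functional_integral_\<mu> bb])
    fix B :: "real set" assume B: "B \<in> sets borel"
    show "polar_form (scalar_measure E) (indicator B) x x =
        complex_of_real (integral\<^sup>L (scalar_measure E x) (indicator B))"
      unfolding polar_form_indicator[OF B] integral_indicator_\<mu>[OF B] measure_scalar_measure[OF B]
      by (rule E_quadratic[OF B])
  qed
qed

section \<open>Projections of disjoint and nested sets\<close>

lemma E_union:
  assumes "B \<in> sets borel" "C \<in> sets borel" "B \<inter> C = {}"
  shows "E (B \<union> C) x = E B x + E C x"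
proof (rule cinner_eqI)
  fix z
  have "indicator (B \<union> C) = (\<lambda>t. indicator B t + indicator C t :: real)"
    using assms(3) by (intro ext) (auto simp: indicator_def)
  then show "cinner (E (B \<union> C) x) z = cinner (E B x + E C x) z"
    using assms(1,2) sf_plus[OF sigma_functional_polar_form[of x z], of "indicator B" "indicator C"]
    by (simp add: bounded_borel_indicator cinner_add_left flip: polar_form_indicator)
qed

text \<open>A count of mass: since \<open>E C\<close> fixes \<open>E C x\<close>, the scalar measure
  of this vector has its whole mass on \<open>C\<close>, and nothing is left for
  \<open>B\<close>.\<close>

lemma E_disjoint:
  assumes B: "B \<in> sets borel" and C: "C \<in> sets borel" and "B \<inter> C = {}"
  shows "E B (E C x) = 0"
proof -
  let ?M = "scalar_measure E (E C x)"
  interpret finite_measure ?M by (rule finite_measure_\<mu>)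
  have "measure ?M B + measure ?M C = measure ?M (B \<union> C)"
    using assms by (subst finite_measure_Union) (auto simp: sets_\<mu>)
  also have "\<dots> \<le> measure ?M UNIV"
    using B C by (intro finite_measure_mono) (auto simp: sets_\<mu>)
  finally have "(norm (E B (E C x)))\<^sup>2 \<le> 0"
    using B C by (simp add: measure_scalar_measure E_UNIV E_idem)
  then show ?thesis by simp
qed

lemma E_subset:
  assumes B: "B \<in> sets borel" and C: "C \<in> sets borel" and "C \<subseteq> B"
  shows "E B (E C x) = E C x"
proof -
  have "E B (E C x) + E (- B) (E C x) = E UNIV (E C x)"
    using E_union[of B "- B" "E C x"] B by simp
  moreover have "E (- B) (E C x) = 0"
    using assms by (intro E_disjoint) auto
  ultimately show ?thesis by (simp add: E_UNIV)
qed

text \<open>The polarized measure of \<open>E B x\<close> and \<open>y\<close> lives on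
  \<open>B\<close>: a Borel set \<open>C\<close> contributes only through
  \<open>B \<inter> C\<close>.\<close>

lemma polar_form_restrict:
  assumes B: "B \<in> sets borel" and bb: "bounded_borel \<phi>"
  shows "polar_form (scalar_measure E) \<phi> (E B x) y =
    polar_form (scalar_measure E) (\<lambda>t. indicator B t * \<phi> t) (E B x) y"
proof (rule sigma_functional_eqI[OF sigma_functional_polar_form
      sigma_functional_mult[OF sigma_functional_polar_form bounded_borel_indicator[OF B]] bb])
  fix C :: "real set" assume C: "C \<in> sets borel"
  have "E C (E B x) = E ((B \<inter> C) \<union> (C - B)) (E B x)" by (rule arg_cong[of _ _ "\<lambda>S. E S (E B x)"]) auto
  also have "\<dots> = E (B \<inter> C) (E B x) + E (C - B) (E B x)"
    using B C by (intro E_union) auto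
  also have "E (C - B) (E B x) = 0" using B C by (intro E_disjoint) auto
  finally have "E C (E B x) = E (B \<inter> C) (E B x)" by simp
  moreover have "(\<lambda>t. indicator B t * indicator C t) = (indicator (B \<inter> C) :: real \<Rightarrow> real)"
    by (intro ext) (auto simp: indicator_def)
  ultimately show "polar_form (scalar_measure E) (indicator C) (E B x) y =
      polar_form (scalar_measure E) (\<lambda>t. indicator B t * indicator C t) (E B x) y"
    using B C by (simp add: polar_form_indicator)
qed

text \<open>On the range of the spectral projection of a bounded set the operator is bounded and everywhere
  defined, and there its quadratic form is the integral of \<open>t\<close>.\<close>

lemma E_neg_bounded_eq_0:
  assumes nonneg: "\<And>x y. (x, y) \<in> polar_operator (scalar_measure E) (\<lambda>t. t) \<Longrightarrow> 0 \<le> Re (cinner y x)"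
  shows "E {- real n..<0} u = 0"
proof -
  define B where "B = {- real n..<0}"
  define x where "x = E B u"
  have B: "B \<in> sets borel" by (simp add: B_def)
  have AE_B: "AE t in scalar_measure E x. t \<in> B"
  proof (rule AE_I[of _ _ "- B"])
    show "emeasure (scalar_measure E x) (- B) = 0"
      using B by (simp add: emeasure_scalar_measure x_def E_disjoint)
  qed (use B in \<open>auto simp: sets_\<mu>\<close>)
  define \<phi> where "\<phi> t = indicator B t * t" for t :: real
  have bb: "bounded_borel \<phi>"
    unfolding \<phi>_def by (rule bounded_borel_indicator_mult[OF B, where C="real n"]) (auto simp: B_def)
  have x_dom: "x \<in> square_integrable_vectors (scalar_measure E) (\<lambda>t. t)"
  proof -
    interpret finite_measure "scalar_measure E x" by (rule finite_measure_\<mu>)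
    have "AE t in scalar_measure E x. norm (t\<^sup>2) \<le> (real n)\<^sup>2"
      using AE_B
    proof eventually_elim
      case (elim t)
      then show ?case by (auto simp: B_def abs_le_square_iff[symmetric])
    qed
    then show ?thesis unfolding square_integrable_vectors_def mem_Collect_eq
      by (rule integrable_const_bound) (simp add: measurable_\<mu>)
  qed
  obtain T where T: "\<And>v z. cinner (T v) z = polar_form (scalar_measure E) \<phi> v z"
    by (rule operator_of_function[OF bb]) blast
  \<comment> \<open>Since \<open>B\<close> is bounded, the truncations of \<open>t\<close> agree
    with \<open>\<phi>\<close> on \<open>B\<close> from \<open>N = n\<close> on. As \<open>x\<close>
    is in the range of \<open>E B\<close>, the form of the operator at \<open>x\<close> is therefore
    the bounded form of \<open>T\<close>.\<close>
  have "(x, T x) \<in> polar_operator (scalar_measure E) (\<lambda>t. t)"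
    unfolding polar_operator_def mem_Collect_eq prod.case
  proof (intro conjI ballI x_dom)
    fix z assume z: "z \<in> square_integrable_vectors (scalar_measure E) (\<lambda>t. t)"
    let ?f = "\<lambda>N t. indicator {t. \<bar>t\<bar> \<le> real N} t * t"
    have "(\<lambda>N. polar_form (scalar_measure E) (?f N) x z) \<longlonglongrightarrow> polar_form (scalar_measure E) (\<lambda>t. t) x z"
      by (rule polar_form_truncation_tendsto[OF integrable_polar[OF _ x_dom z]]) simp_all
    moreover have "(\<lambda>N. polar_form (scalar_measure E) (?f N) x z) \<longlonglongrightarrow> polar_form (scalar_measure E) \<phi> x z"
    proof (rule tendsto_eventually, rule eventually_sequentiallyI)
      fix N assume "n \<le> N"
      then have "(\<lambda>t. indicator B t * ?f N t) = \<phi>"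
        by (auto simp: fun_eq_iff \<phi>_def B_def indicator_def)
      then show "polar_form (scalar_measure E) (?f N) x z = polar_form (scalar_measure E) \<phi> x z"
        unfolding x_def
        by (subst polar_form_restrict[OF B bounded_borel_truncation]) simp_all
    qed
    ultimately show "cinner (T x) z = polar_form (scalar_measure E) (\<lambda>t. t) x z"
      unfolding T by (rule LIMSEQ_unique[symmetric])
  qed
  \<comment> \<open>The operator is nonnegative, so the integral of \<open>t\<close> is too; but
    \<open>t < 0\<close> almost everywhere. Hence the measure is null and
    \<open>x = 0\<close>.\<close>
  from nonneg[OF this] polar_operator_quadratic_form[OF _ this]
  have "0 \<le> integral\<^sup>L (scalar_measure E x) (\<lambda>t. t)" by simp
  moreover have int: "integrable (scalar_measure E x) (\<lambda>t. t)"
    using integrable_polar[OF _ x_dom x_dom, of 0] by simp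
  moreover have neg: "AE t in scalar_measure E x. 0 \<le> - t"
    using AE_B by eventually_elim (simp add: B_def)
  ultimately have "integral\<^sup>L (scalar_measure E x) (\<lambda>t. - t) = 0"
    using integral_nonneg_AE[OF neg] by simp
  then have "AE t in scalar_measure E x. - t = 0"
    by (subst (asm) integral_nonneg_eq_0_iff_AE) (use int neg in auto)
  with AE_B have "AE t in scalar_measure E x. False"
    by eventually_elim (simp add: B_def)
  then have "emeasure (scalar_measure E x) UNIV = 0"
    unfolding eventually_False ae_filter_eq_bot_iff space_\<mu> .
  then have "norm x = 0" by (simp add: emeasure_\<mu>)
  then show ?thesis by (simp add: x_def B_def)
qed

lemma E_neg_eq_0:
  assumes nonneg: "\<And>x y. (x, y) \<in> polar_operator (scalar_measure E) (\<lambda>t. t) \<Longrightarrow> 0 \<le> Re (cinner y x)"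
  shows "E {..<0} u = 0"
proof -
  have "{..<0::real} = (\<Union>n. {- real n..<0})"
  proof (intro equalityI subsetI)
    fix t :: real assume "t \<in> {..<0}"
    moreover obtain n where "- t \<le> real n" using real_arch_simple by blast
    ultimately show "t \<in> (\<Union>n. {- real n..<0})" by (intro UN_I[of n]) auto
  qed auto
  moreover have "emeasure (scalar_measure E u) (\<Union>n. {- real n..<0}) = 0"
    by (rule emeasure_UN_eq_0) (auto simp: emeasure_scalar_measure E_neg_bounded_eq_0[OF nonneg] sets_\<mu>)
  ultimately show ?thesis by (simp add: emeasure_scalar_measure)
qed

end

section \<open>The resolvent of a positive self-adjoint operator\<close>

context
  fixes A :: "'a::complex_hilbert operator_graph"
  assumes sa: "self_adjoint A" and nonneg: "\<And>x y. (x, y) \<in> A \<Longrightarrow> 0 \<le> Re (cinner y x)"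
begin

lemma
  shows graph_zero: "(0, 0) \<in> A"
    and graph_add: "(x, y) \<in> A \<Longrightarrow> (x', y') \<in> A \<Longrightarrow> (x + x', y + y') \<in> A"
    and graph_scale: "(x, y) \<in> A \<Longrightarrow> (c *\<^sub>C x, c *\<^sub>C y) \<in> A"
  using sa by (auto simp: self_adjoint_def linear_operator_def)

text \<open>Self-adjointness as a test for membership: a pair that behaves symmetrically against the
  whole graph belongs to it. Both the closedness of the graph and the maximality of \<open>A\<close>
  rest on this.\<close>

lemma graph_iff: "(u, v) \<in> A \<longleftrightarrow> (\<forall>(x, y) \<in> A. cinner y u = cinner x v)"
proof -
  have "adjoint_operator A = A" using sa by (simp add: self_adjoint_def)
  then have "(u, v) \<in> A \<longleftrightarrow> (u, v) \<in> adjoint_operator A" by simp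
  then show ?thesis by (simp add: adjoint_operator_def)
qed

lemma graph_sym: "(x, y) \<in> A \<Longrightarrow> (u, v) \<in> A \<Longrightarrow> cinner y u = cinner x v"
  using graph_iff[of u v] by blast

text \<open>The cross term \<open>2 * Re (cinner y x)\<close> is nonnegative. This inequality yields
  the injectivity of \<open>1 + A\<close>, the closedness of its range and the contraction bound for
  the inverse.\<close>

lemma norm_add_graph_ge:
  assumes "(x, y) \<in> A"
  shows "(norm x)\<^sup>2 + (norm y)\<^sup>2 \<le> (norm (x + y))\<^sup>2"
  using nonneg[OF assms] norm_add_sq[of y x] by (simp add: add.commute)

lemma graph_diff: "(x, y) \<in> A \<Longrightarrow> (x', y') \<in> A \<Longrightarrow> (x - x', y - y') \<in> A"
  using graph_add[of x y "- x'" "- y'"] graph_scale[of x' y' "-1"] by simp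

lemma graph_sum_inj:
  assumes "(x, y) \<in> A" "(x', y') \<in> A" "x + y = x' + y'"
  shows "x = x'"
proof -
  have "(x - x') + (y - y') = 0" using assms(3) by (simp add: algebra_simps)
  then have "(norm (x - x'))\<^sup>2 + (norm (y - y'))\<^sup>2 \<le> 0"
    using norm_add_graph_ge[OF graph_diff[OF assms(1,2)]] by simp
  then have "(norm (x - x'))\<^sup>2 \<le> 0"
    using zero_le_power2[of "norm (y - y')"] by linarith
  then show ?thesis by simp
qed

lemma graph_closed:
  assumes "\<And>n. (a n, b n) \<in> A" "a \<longlonglongrightarrow> u" "b \<longlonglongrightarrow> v"
  shows "(u, v) \<in> A"
  unfolding graph_iff
proof (intro ballI, clarify)
  fix x y assume xy: "(x, y) \<in> A"
  have "(\<lambda>n. cinner y (a n)) \<longlonglongrightarrow> cinner y u" "(\<lambda>n. cinner x (b n)) \<longlonglongrightarrow> cinner x v"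
    by (intro tendsto_cinner tendsto_const assms)+
  moreover have "cinner y (a n) = cinner x (b n)" for n
    by (rule graph_sym[OF xy assms(1)])
  ultimately show "cinner y u = cinner x v"
    using LIMSEQ_unique by simp
qed

text \<open>If the sums \<open>x + y\<close> converge, \<open>norm_add_graph_ge\<close> makes both
  components Cauchy, and the closed graph contains their limit.\<close>

lemma closed_graph_sums: "closed {x + y | x y. (x, y) \<in> A}"
  unfolding closed_sequential_limits
proof (intro allI impI, elim conjE)
  fix s w assume "\<forall>n. s n \<in> {x + y | x y. (x, y) \<in> A}" and lim: "s \<longlonglongrightarrow> w"
  then have "\<forall>n. \<exists>p. s n = fst p + snd p \<and> p \<in> A" by fastforce
  then obtain p where p: "\<And>n. s n = fst (p n) + snd (p n)" "\<And>n. p n \<in> A" by metis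
  define a b where "a n = fst (p n)" and "b n = snd (p n)" for n
  have ab: "(a n, b n) \<in> A" "s n = a n + b n" for n using p[of n] by (simp_all add: a_def b_def)
  have le: "norm (a n - a m) \<le> norm (s n - s m)" "norm (b n - b m) \<le> norm (s n - s m)" for n m
  proof -
    have eq: "(a n - a m) + (b n - b m) = s n - s m" by (simp add: ab(2))
    have "(norm (a n - a m))\<^sup>2 + (norm (b n - b m))\<^sup>2 \<le> (norm (s n - s m))\<^sup>2"
      using norm_add_graph_ge[OF graph_diff[OF ab(1)[of n] ab(1)[of m]]] unfolding eq .
    then have "(norm (a n - a m))\<^sup>2 \<le> (norm (s n - s m))\<^sup>2" "(norm (b n - b m))\<^sup>2 \<le> (norm (s n - s m))\<^sup>2"
      using zero_le_power2[of "norm (b n - b m)"] zero_le_power2[of "norm (a n - a m)"] by linarith+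
    then show "norm (a n - a m) \<le> norm (s n - s m)" "norm (b n - b m) \<le> norm (s n - s m)"
      by (auto intro: power2_le_imp_le)
  qed
  have "Cauchy s" using lim LIMSEQ_imp_Cauchy by blast
  then have "Cauchy a" "Cauchy b"
    unfolding Cauchy_iff by (meson le le_less_trans)+
  then obtain u v where uv: "a \<longlonglongrightarrow> u" "b \<longlonglongrightarrow> v"
    by (meson Cauchy_convergent convergentD)
  then have "(u, v) \<in> A" by (rule graph_closed[OF ab(1)])
  moreover have "s \<longlonglongrightarrow> u + v"
    using tendsto_add[OF uv] by (simp add: ab(2)[abs_def])
  then have "w = u + v" using lim LIMSEQ_unique by blast
  ultimately show "w \<in> {x + y | x y. (x, y) \<in> A}" by blast
qed

text \<open>By self-adjointness, a vector \<open>v\<close> orthogonal to the range of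
  \<open>1 + A\<close> satisfies \<open>A v = - v\<close>; nonnegativity then gives
  \<open>v = 0\<close>. As the range is closed, it is the whole space.\<close>

lemma graph_sums_surj: "\<exists>x. (x, w - x) \<in> A"
proof -
  let ?M = "{x + y | x y. (x, y) \<in> A}"
  obtain m where m: "m \<in> ?M" "\<And>z. z \<in> ?M \<Longrightarrow> cinner (w - m) z = 0"
  proof (rule orthogonal_decomposition[of ?M w])
    show "closed ?M" by (rule closed_graph_sums)
    show "0 \<in> ?M" using graph_zero by force
    show "p + q \<in> ?M" if pq: "p \<in> ?M" "q \<in> ?M" for p q
    proof -
      obtain x y x' y' where "(x, y) \<in> A" "(x', y') \<in> A" "p = x + y" "q = x' + y'"
        using pq by blast
      then have "(x + x', y + y') \<in> A" "p + q = (x + x') + (y + y')"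
        using graph_add by (auto simp: algebra_simps)
      then show ?thesis by blast
    qed
    show "c *\<^sub>C p \<in> ?M" if p: "p \<in> ?M" for c p
    proof -
      obtain x y where "(x, y) \<in> A" "p = x + y" using p by blast
      then have "(c *\<^sub>C x, c *\<^sub>C y) \<in> A" "c *\<^sub>C p = c *\<^sub>C x + c *\<^sub>C y"
        using graph_scale by (auto simp: scaleC_add_right)
      then show ?thesis by blast
    qed
  qed blast
  define v where "v = w - m"
  have "(v, - v) \<in> A"
    unfolding graph_iff
  proof (intro ballI, clarify)
    fix x y assume "(x, y) \<in> A"
    then have "cinner v (x + y) = 0" using m(2)[of "x + y"] unfolding v_def by blast
    then have "cinner (x + y) v = 0" by (metis cinner_commute complex_cnj_zero)
    then show "cinner y v = cinner x (- v)"
      by (simp add: cinner_add_left cinner_minus_right eq_neg_iff_add_eq_0 add.commute)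
  qed
  from nonneg[OF this] have "(norm v)\<^sup>2 \<le> 0"
    by (simp add: cinner_minus_left Re_cinner_self)
  then have "w = m" by (simp add: v_def)
  with m(1) obtain x y where "(x, y) \<in> A" "w = x + y" by blast
  then show ?thesis by (intro exI[of _ x]) simp
qed

text \<open>The second and third properties say that \<open>R\<close> inverts \<open>1 + A\<close>.
  The last one, \<open>R R \<le> R\<close> in the sense of forms, is the nonnegativity of
  \<open>A\<close> at the pair \<open>(R w, w - R w)\<close>.\<close>

lemma resolvent_exists:
  obtains R where "bounded_clinear R" "\<And>x y. (x, y) \<in> A \<Longrightarrow> R (x + y) = x"
    "\<And>w. (R w, w - R w) \<in> A"
    "\<And>w z. cinner (R w) z = cinner w (R z)" "\<And>w. (norm (R w))\<^sup>2 \<le> Re (cinner (R w) w)"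
proof -
  obtain R where R: "\<And>w. (R w, w - R w) \<in> A" using graph_sums_surj by metis
  have unique: "R (x + y) = x" if "(x, y) \<in> A" for x y
    by (rule graph_sum_inj[OF R that]) simp
  have add: "R (w + z) = R w + R z" for w z
    using unique[OF graph_add[OF R[of w] R[of z]]] by simp
  have scale: "R (c *\<^sub>C w) = c *\<^sub>C R w" for c w
    using unique[OF graph_scale[OF R[of w], of c]] by (simp add: scaleC_diff_right)
  have le: "norm (R w) \<le> norm w" for w
  proof (rule power2_le_imp_le)
    have "(norm (R w))\<^sup>2 + (norm (w - R w))\<^sup>2 \<le> (norm w)\<^sup>2"
      using norm_add_graph_ge[OF R[of w]] by simp
    then show "(norm (R w))\<^sup>2 \<le> (norm w)\<^sup>2"
      using zero_le_power2[of "norm (w - R w)"] by linarith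
  qed simp
  have "bounded_clinear R"
    unfolding bounded_clinear_def
    by (intro conjI allI scale bounded_linear_intro[where K=1])
      (use le in \<open>auto simp: add scale scaleR_scaleC\<close>)
  moreover have "cinner (R w) z = cinner w (R z)" for w z
  proof -
    have "cinner (w - R w) (R z) = cinner (R w) (z - R z)" by (rule graph_sym[OF R R])
    then show ?thesis by (simp add: cinner_diff_left cinner_diff_right)
  qed
  moreover have "(norm (R w))\<^sup>2 \<le> Re (cinner (R w) w)" for w
  proof -
    have "Re (cinner (R w) w) = Re (cinner w (R w))"
      by (subst cinner_commute) simp
    then show ?thesis
      using nonneg[OF R[of w]] by (simp add: cinner_diff_left Re_cinner_self)
  qed
  ultimately show ?thesis using that[of R] unique R by blast
qed

end

section \<open>The spectral measures of a positive contraction\<close>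

lemma concentrated_01_add: "concentrated_01 \<Lambda> \<Longrightarrow> concentrated_01 \<Lambda>' \<Longrightarrow> concentrated_01 (\<lambda>\<phi>. \<Lambda> \<phi> + \<Lambda>' \<phi>)"
  and concentrated_01_scale: "concentrated_01 \<Lambda> \<Longrightarrow> concentrated_01 (\<lambda>\<phi>. c * \<Lambda> \<phi>)"
  and concentrated_01_cnj: "concentrated_01 \<Lambda> \<Longrightarrow> concentrated_01 (\<lambda>\<phi>. cnj (\<Lambda> \<phi>))"
  by (simp_all add: concentrated_01_def)

lemma concentrated_01_mult:
  assumes "concentrated_01 \<Lambda>" "bounded_borel h"
  shows "concentrated_01 (\<lambda>\<phi>. \<Lambda> (\<lambda>t. h t * \<phi> t))"
  unfolding concentrated_01_def
proof (intro allI impI)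
  fix \<phi> :: "real \<Rightarrow> real" assume "bounded_borel \<phi>" "\<forall>t\<in>{0..1}. \<phi> t = 0"
  then show "\<Lambda> (\<lambda>t. h t * \<phi> t) = 0"
    using assms(1)[unfolded concentrated_01_def, rule_format, OF bounded_borel_mult[OF assms(2)], of \<phi>] by simp
qed

text \<open>The inequality \<open>R_contr\<close> encodes \<open>0 \<le> R \<le> 1\<close>: it
  contains the positivity of \<open>R\<close> and of \<open>R (1 - R)\<close>, and it implies the
  norm bound.\<close>

locale positive_contraction =
  fixes R :: "'a::complex_hilbert \<Rightarrow> 'a"
  assumes clinear_R: "bounded_clinear R"
    and R_sym: "cinner (R x) y = cinner x (R y)"
    and R_contr: "(norm (R x))\<^sup>2 \<le> Re (cinner (R x) x)"
begin

lemma R_add: "R (x + y) = R x + R y" and R_scale: "R (c *\<^sub>C x) = c *\<^sub>C R x"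
  using clinear_R by (auto simp: bounded_clinear_def linear_add bounded_linear.linear)

lemma R_diff: "R (x - y) = R x - R y"
  using R_add[of x "(-1) *\<^sub>C y"] by (simp only: R_scale) simp

lemma clinear_R_power: "bounded_clinear (R ^^ n)"
proof (induction n)
  case 0
  then show ?case by (simp add: bounded_clinear_def bounded_linear_ident id_def)
next
  case (Suc n)
  then show ?case
    using clinear_R by (auto simp: bounded_clinear_def o_def intro: bounded_linear_compose)
qed

lemma R_power_add: "(R ^^ n) (x + y) = (R ^^ n) x + (R ^^ n) y"
  by (induction n) (simp_all add: R_add)

lemma R_power_sym: "cinner ((R ^^ n) x) y = cinner x ((R ^^ n) y)"
  by (induction n arbitrary: x y) (simp_all add: R_sym funpow_swap1)

lemma R_power_real: "complex_of_real (Re (cinner ((R ^^ n) x) x)) = cinner ((R ^^ n) x) x"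
proof -
  have "cinner ((R ^^ n) x) x = cnj (cinner ((R ^^ n) x) x)"
    by (metis R_power_sym cinner_commute)
  then have "Im (cinner ((R ^^ n) x) x) = 0" by (simp add: complex_eq_iff)
  then show ?thesis by (simp add: complex_eq_iff)
qed

definition Q :: "'a \<Rightarrow> 'a" where "Q x = x - R x"

lemma Q_sym: "cinner (Q x) y = cinner x (Q y)"
  by (simp add: Q_def cinner_diff_left cinner_diff_right R_sym)

lemma Q_R: "Q (R x) = R (Q x)"
  by (simp add: Q_def R_diff)

lemma Q_power_R: "(Q ^^ l) (R x) = R ((Q ^^ l) x)"
  by (induction l) (simp_all add: Q_R)

lemma Q_R_power: "Q ((R ^^ k) x) = (R ^^ k) (Q x)"
  by (induction k) (simp_all add: Q_R)

lemma norm_R_le: "norm (R x) \<le> norm x"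
proof (cases "R x = 0")
  case False
  have "(norm (R x))\<^sup>2 \<le> norm (R x) * norm x"
    using R_contr[of x] complex_Re_le_cmod[of "cinner (R x) x"] cauchy_schwarz[of "R x" x] by linarith
  then show ?thesis using False by (simp add: power2_eq_square)
qed simp

definition W :: "'a \<Rightarrow> nat \<Rightarrow> nat \<Rightarrow> real" where
  "W x k l = Re (cinner ((R ^^ k) ((Q ^^ l) x)) x)"

text \<open>One of two factors \<open>R\<close> is moved across the inner product and the other is
  applied to the vector, so the exponent drops by two at the cost of a new vector.\<close>

lemma W_Suc_Suc_left: "W x (Suc (Suc k)) l = W (R x) k l"
proof -
  have "cinner ((R ^^ Suc (Suc k)) ((Q ^^ l) x)) x = cinner (R ((R ^^ k) ((Q ^^ l) x))) (R x)"
    by (simp add: R_sym)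
  also have "R ((R ^^ k) ((Q ^^ l) x)) = (R ^^ k) ((Q ^^ l) (R x))"
    by (simp add: Q_power_R funpow_swap1)
  finally show ?thesis by (simp add: W_def)
qed

lemma W_Suc_Suc_right: "W x k (Suc (Suc l)) = W (Q x) k l"
proof -
  have "cinner ((R ^^ k) ((Q ^^ Suc (Suc l)) x)) x = cinner (Q ((R ^^ k) ((Q ^^ l) (Q x)))) x"
    by (simp add: Q_R_power funpow_swap1)
  then show ?thesis by (simp add: W_def Q_sym)
qed

text \<open>Lowering the exponents by two leaves four base cases, the forms of \<open>1\<close>,
  \<open>1 - R\<close>, \<open>R\<close> and \<open>R (1 - R)\<close>. The induction takes the place
  of square roots of positive operators.\<close>

lemma W_nonneg: "0 \<le> W x k l"
proof (induction k arbitrary: x l rule: nat_less_induct)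
  case k: (1 k)
  consider "k = 0" | "k = 1" | j where "k = Suc (Suc j)"
    by (metis One_nat_def not0_implies_Suc)
  then show ?case
  proof cases
    case 3
    then show ?thesis using k by (simp add: W_Suc_Suc_left)
  next
    case 1
    show ?thesis
      unfolding 1
    proof (induction l arbitrary: x rule: nat_less_induct)
      case l: (1 l)
      consider "l = 0" | "l = 1" | j where "l = Suc (Suc j)"
        by (metis One_nat_def not0_implies_Suc)
      then show ?case
      proof cases
        case 2
        have "Re (cinner (R x) x) \<le> norm (R x) * norm x"
          using complex_Re_le_cmod[of "cinner (R x) x"] cauchy_schwarz[of "R x" x] by linarith
        also have "\<dots> \<le> (norm x)\<^sup>2"
          unfolding power2_eq_square by (intro mult_right_mono norm_R_le) simp
        finally show ?thesis using 2 by (simp add: W_def Q_def cinner_diff_left Re_cinner_self)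
      qed (use l in \<open>simp_all add: W_Suc_Suc_right, simp add: W_def Re_cinner_self\<close>)
    qed
  next
    case 2
    show ?thesis
      unfolding 2
    proof (induction l arbitrary: x rule: nat_less_induct)
      case l: (1 l)
      consider "l = 0" | "l = 1" | j where "l = Suc (Suc j)"
        by (metis One_nat_def not0_implies_Suc)
      then show ?case
      proof cases
        case 1
        then show ?thesis
          using order_trans[OF zero_le_power2 R_contr[of x]] by (simp add: W_def)
      next
        case 2
        \<comment> \<open>The base case \<open>R (1 - R)\<close> is exactly
          \<open>R_contr\<close>.\<close>
        have "Re (cinner (R (Q x)) x) = Re (cinner (R x) x) - (norm (R x))\<^sup>2"
          by (simp add: Q_def R_diff cinner_diff_left R_sym[of "R x" x] Re_cinner_self)
        then show ?thesis
          using 2 R_contr[of x] by (simp add: W_def)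
      qed (use l in \<open>simp add: W_Suc_Suc_right\<close>)
    qed
  qed
qed

lemma W_split: "W x k l = W x (Suc k) l + W x k (Suc l)"
proof -
  let ?z = "(Q ^^ l) x"
  have "(R ^^ k) ?z = (R ^^ k) (R ?z + Q ?z)" by (simp add: Q_def)
  also have "\<dots> = (R ^^ Suc k) ?z + (R ^^ k) ((Q ^^ Suc l) x)"
    by (simp only: R_power_add funpow_Suc_right[of k] funpow.simps(2)[of l] o_apply)
  finally show ?thesis by (simp only: W_def cinner_add_left plus_complex.sel)
qed

text \<open>A solution is merely selected for each \<open>x\<close>; that it depends quadratically
  on \<open>x\<close> is recovered afterwards from the moments.\<close>

definition \<mu> :: "'a \<Rightarrow> real measure" where
  "\<mu> x = (SOME M. finite_measure M \<and> sets M = sets borel \<and> (AE t in M. t \<in> {0..1}) \<and>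
      (\<forall>n. integral\<^sup>L M (\<lambda>t. t ^ n) = W x n 0))"

lemma
  shows fin_\<mu>: "finite_measure (\<mu> x)" and sets_\<mu>: "sets (\<mu> x) = sets borel"
    and AE_\<mu>: "AE t in \<mu> x. t \<in> {0..1}"
    and moment_\<mu>: "integral\<^sup>L (\<mu> x) (\<lambda>t. t ^ n) = W x n 0"
proof -
  have "\<exists>M. finite_measure M \<and> sets M = sets borel \<and> (AE t in M. t \<in> {0..1}) \<and>
      (\<forall>n. integral\<^sup>L M (\<lambda>t. t ^ n) = W x n 0)"
    by (rule hausdorff_moments[of "W x", OF W_nonneg W_split]) blast
  then have "finite_measure (\<mu> x) \<and> sets (\<mu> x) = sets borel \<and> (AE t in \<mu> x. t \<in> {0..1}) \<and>
      (\<forall>n. integral\<^sup>L (\<mu> x) (\<lambda>t. t ^ n) = W x n 0)"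
    unfolding \<mu>_def by (rule someI_ex)
  then show "finite_measure (\<mu> x)" "sets (\<mu> x) = sets borel" "AE t in \<mu> x. t \<in> {0..1}"
    "integral\<^sup>L (\<mu> x) (\<lambda>t. t ^ n) = W x n 0"
    by blast+
qed

sublocale measure_family \<mu>
proof
  show "sets (\<mu> x) = sets borel" for x by (rule sets_\<mu>)
  fix x
  interpret finite_measure "\<mu> x" by (rule fin_\<mu>)
  have space: "space (\<mu> x) = UNIV" using sets_eq_imp_space_eq[OF sets_\<mu>] by simp
  have "measure (\<mu> x) UNIV = (norm x)\<^sup>2"
    using moment_\<mu>[of x 0] by (simp add: W_def Re_cinner_self space)
  then show "emeasure (\<mu> x) UNIV = ennreal ((norm x)\<^sup>2)"
    by (simp add: emeasure_eq_measure)
qed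

lemma integral_moment: "complex_of_real (integral\<^sup>L (\<mu> x) (\<lambda>t. indicator {0..1} t * t ^ n)) = cinner ((R ^^ n) x) x"
proof -
  have "integral\<^sup>L (\<mu> x) (\<lambda>t. indicator {0..1} t * t ^ n) = integral\<^sup>L (\<mu> x) (\<lambda>t. t ^ n)"
  proof (rule integral_cong_AE)
    show "AE t in \<mu> x. indicator {0..1} t * t ^ n = t ^ n"
      using AE_\<mu> by eventually_elim simp
  qed (simp_all add: measurable_\<mu>)
  then show ?thesis by (simp add: moment_\<mu> W_def R_power_real)
qed

lemma polar_moment: "polar_form \<mu> (\<lambda>t. indicator {0..1} t * t ^ n) x y = cinner ((R ^^ n) x) y"
  unfolding polar_form_def integral_moment by (rule polarization[OF clinear_R_power])

lemma integral_eq_0_01: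
  assumes "bounded_borel \<phi>" "\<forall>t\<in>{0..1}. \<phi> t = 0"
  shows "integral\<^sup>L (\<mu> x) \<phi> = 0"
proof (rule integral_eq_zero_AE)
  show "AE t in \<mu> x. \<phi> t = 0"
    using AE_\<mu> by eventually_elim (use assms(2) in blast)
qed

lemma concentrated_01_integral: "concentrated_01 (\<lambda>\<phi>. complex_of_real (integral\<^sup>L (\<mu> x) \<phi>))"
  by (simp add: concentrated_01_def integral_eq_0_01)

lemma concentrated_01_polar_form: "concentrated_01 (\<lambda>\<phi>. polar_form \<mu> \<phi> x y)"
  by (simp add: concentrated_01_def polar_form_def integral_eq_0_01)

lemmas sf_polar = sigma_functional_polar_form and c01_polar = concentrated_01_polar_form

sublocale spectral_family \<mu>
proof
  fix \<phi> :: "real \<Rightarrow> real" and x x' y :: 'a and c :: complex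
  assume bb: "bounded_borel \<phi>"
  have clin: "(R ^^ n) (u + v) = (R ^^ n) u + (R ^^ n) v" "(R ^^ n) (c *\<^sub>C u) = c *\<^sub>C (R ^^ n) u" for n u v
    using clinear_R_power[of n] by (auto simp: bounded_clinear_def linear_add bounded_linear.linear)
  show "polar_form \<mu> \<phi> (x + x') y = polar_form \<mu> \<phi> x y + polar_form \<mu> \<phi> x' y"
    by (rule sigma_functional_eqI_moments[OF sf_polar sigma_functional_add[OF sf_polar sf_polar]
        c01_polar concentrated_01_add[OF c01_polar c01_polar] _ bb])
      (simp only: polar_moment clin cinner_add_left)
  show "polar_form \<mu> \<phi> (c *\<^sub>C x) y = c * polar_form \<mu> \<phi> x y"
    by (rule sigma_functional_eqI_moments[OF sf_polar sigma_functional_scale[OF sf_polar]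
        c01_polar concentrated_01_scale[OF c01_polar] _ bb])
      (simp only: polar_moment clin cinner_scaleC_left)
  show "polar_form \<mu> \<phi> y x = cnj (polar_form \<mu> \<phi> x y)"
  proof (rule sigma_functional_eqI_moments[OF sf_polar sigma_functional_cnj[OF sf_polar]
        c01_polar concentrated_01_cnj[OF c01_polar] _ bb])
    show "polar_form \<mu> (\<lambda>t. indicator {0..1} t * t ^ n) y x =
        cnj (polar_form \<mu> (\<lambda>t. indicator {0..1} t * t ^ n) x y)" for n
      unfolding polar_moment R_power_sym[of n y] by (rule cinner_commute)
  qed
  show "polar_form \<mu> \<phi> x x = complex_of_real (integral\<^sup>L (\<mu> x) \<phi>)"
    by (rule sigma_functional_eqI_moments[OF sf_polar sigma_functional_integral_\<mu>
        c01_polar concentrated_01_integral _ bb])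
      (simp only: polar_moment integral_moment)
qed

text \<open>Applying \<open>R\<close> to the vector raises the exponent of each moment by one, so
  the polarized measure is multiplied by \<open>t\<close>.\<close>

lemma polar_form_R:
  assumes bb: "bounded_borel \<phi>"
  shows "polar_form \<mu> \<phi> (R x) y = polar_form \<mu> (\<lambda>t. (indicator {0..1} t * t) * \<phi> t) x y"
proof (rule sigma_functional_eqI_moments[OF sf_polar _ c01_polar _ _ bb])
  have h: "bounded_borel (\<lambda>t. indicator {0..1} t * t)"
    using bounded_borel_01_power[of 1] by simp
  show "sigma_functional (\<lambda>\<phi>. polar_form \<mu> (\<lambda>t. (indicator {0..1} t * t) * \<phi> t) x y)"
    by (rule sigma_functional_mult[OF sf_polar h])
  show "concentrated_01 (\<lambda>\<phi>. polar_form \<mu> (\<lambda>t. (indicator {0..1} t * t) * \<phi> t) x y)"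
    by (rule concentrated_01_mult[OF c01_polar h])
  fix n
  have "(\<lambda>t::real. indicator {0..1} t * t * (indicator {0..1} t * t ^ n)) = (\<lambda>t. indicator {0..1} t * t ^ Suc n)"
    by (auto simp: indicator_def)
  then show "polar_form \<mu> (\<lambda>t. indicator {0..1} t * t ^ n) (R x) y =
      polar_form \<mu> (\<lambda>t. (indicator {0..1} t * t) * (indicator {0..1} t * t ^ n)) x y"
    by (simp only: polar_moment funpow_Suc_right o_apply)
qed

lemma polar_form_R_power_right:
  assumes bb: "bounded_borel \<phi>"
  shows "polar_form \<mu> \<phi> x ((R ^^ n) y) = polar_form \<mu> (\<lambda>t. (indicator {0..1} t * t ^ n) * \<phi> t) x y"
proof (rule sigma_functional_eqI_moments[OF sf_polar sigma_functional_mult[OF sf_polar bounded_borel_01_power]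
      c01_polar concentrated_01_mult[OF c01_polar bounded_borel_01_power] _ bb])
  fix m
  have "(\<lambda>t::real. indicator {0..1} t * t ^ n * (indicator {0..1} t * t ^ m)) = (\<lambda>t. indicator {0..1} t * t ^ (n + m))"
    by (auto simp: indicator_def power_add)
  then show "polar_form \<mu> (\<lambda>t. indicator {0..1} t * t ^ m) x ((R ^^ n) y) =
      polar_form \<mu> (\<lambda>t. (indicator {0..1} t * t ^ n) * (indicator {0..1} t * t ^ m)) x y"
    by (simp only: polar_moment funpow_add o_apply R_power_sym)
qed

text \<open>The moments on the left are inner products of \<open>T x\<close> with
  \<open>(R ^^ n) y\<close>, hence values of the form that defines \<open>T\<close>. So the measure
  of \<open>T x\<close> is that of \<open>x\<close> cut down to \<open>B\<close>; with
  \<open>\<phi>\<close> an indicator this is the multiplicativity that makes \<open>T\<close> a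
  projection.\<close>

lemma polar_form_projection:
  assumes B: "B \<in> sets borel" and T: "\<And>x y. cinner (T x) y = polar_form \<mu> (indicator B) x y"
    and bb: "bounded_borel \<phi>"
  shows "polar_form \<mu> \<phi> (T x) y = polar_form \<mu> (\<lambda>t. indicator B t * \<phi> t) x y"
proof (rule sigma_functional_eqI_moments[OF sf_polar sigma_functional_mult[OF sf_polar bounded_borel_indicator[OF B]]
      c01_polar concentrated_01_mult[OF c01_polar bounded_borel_indicator[OF B]] _ bb])
  fix n
  have "polar_form \<mu> (\<lambda>t. indicator {0..1} t * t ^ n) (T x) y = cinner (T x) ((R ^^ n) y)"
    by (simp only: polar_moment R_power_sym)
  also have "\<dots> = polar_form \<mu> (\<lambda>t. (indicator {0..1} t * t ^ n) * indicator B t) x y"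
    unfolding T by (rule polar_form_R_power_right[OF bounded_borel_indicator[OF B]])
  finally show "polar_form \<mu> (\<lambda>t. indicator {0..1} t * t ^ n) (T x) y =
      polar_form \<mu> (\<lambda>t. indicator B t * (indicator {0..1} t * t ^ n)) x y"
    by (simp only: mult.commute)
qed

end

section \<open>From quadratic families of measures to projection-valued measures\<close>

text \<open>Change of variables: the operator of the function \<open>g\<close> for one family is the
  operator of the identity for its image under \<open>g\<close>. It is applied to
  \<open>1/t - 1\<close> and to \<open>sqrt\<close>.\<close>

lemma (in measure_family)
  assumes g: "g \<in> borel_measurable borel"
  shows measure_family_distr: "measure_family (\<lambda>x. distr (\<mu> x) borel g)"
    and polar_form_distr: "\<phi> \<in> borel_measurable borel \<Longrightarrow>
      polar_form (\<lambda>x. distr (\<mu> x) borel g) \<phi> x y = polar_form \<mu> (\<lambda>t. \<phi> (g t)) x y"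
    and polar_operator_distr: "polar_operator (\<lambda>x. distr (\<mu> x) borel g) (\<lambda>t. t) = polar_operator \<mu> g"
proof -
  have meas: "g \<in> measurable (\<mu> x) borel" for x using g by (simp add: measurable_\<mu>)
  show "measure_family (\<lambda>x. distr (\<mu> x) borel g)"
    by unfold_locales (simp_all add: emeasure_distr meas space_\<mu> emeasure_\<mu>)
  have form: "polar_form (\<lambda>x. distr (\<mu> x) borel g) \<phi> x y = polar_form \<mu> (\<lambda>t. \<phi> (g t)) x y"
    if "\<phi> \<in> borel_measurable borel" for \<phi> x y
    unfolding polar_form_def integral_distr[OF meas that] ..
  then show "\<phi> \<in> borel_measurable borel \<Longrightarrow>
      polar_form (\<lambda>x. distr (\<mu> x) borel g) \<phi> x y = polar_form \<mu> (\<lambda>t. \<phi> (g t)) x y" .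
  have dom: "square_integrable_vectors (\<lambda>x. distr (\<mu> x) borel g) (\<lambda>t. t) = square_integrable_vectors \<mu> g"
    by (simp add: square_integrable_vectors_def integrable_distr_eq[OF meas])
  have form': "polar_form (\<lambda>x. distr (\<mu> x) borel g) (\<lambda>t. t) = polar_form \<mu> g"
    by (intro ext) (simp add: form)
  show "polar_operator (\<lambda>x. distr (\<mu> x) borel g) (\<lambda>t. t) = polar_operator \<mu> g"
    unfolding polar_operator_def dom form' ..
qed

lemma bounded_borel_compose:
  assumes "bounded_borel \<phi>" "g \<in> borel_measurable borel"
  shows "bounded_borel (\<lambda>t. \<phi> (g t))"
  using assms by (auto simp: bounded_borel_def)

context spectral_family
begin

lemma spectral_family_distr:
  assumes g: "g \<in> borel_measurable borel"
  shows "spectral_family (\<lambda>x. distr (\<mu> x) borel g)"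
proof -
  interpret \<nu>: measure_family "\<lambda>x. distr (\<mu> x) borel g" by (rule measure_family_distr[OF g])
  note form = polar_form_distr[OF g bounded_borel_measurable]
  show ?thesis
  proof
    fix \<phi> :: "real \<Rightarrow> real" and x x' y :: 'a and c :: complex
    assume bb: "bounded_borel \<phi>"
    note bbg = bounded_borel_compose[OF bb g]
    show "polar_form (\<lambda>x. distr (\<mu> x) borel g) \<phi> (x + x') y =
        polar_form (\<lambda>x. distr (\<mu> x) borel g) \<phi> x y + polar_form (\<lambda>x. distr (\<mu> x) borel g) \<phi> x' y"
      unfolding form[OF bb] by (rule form_add[OF bbg])
    show "polar_form (\<lambda>x. distr (\<mu> x) borel g) \<phi> (c *\<^sub>C x) y = c * polar_form (\<lambda>x. distr (\<mu> x) borel g) \<phi> x y"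
      unfolding form[OF bb] by (rule form_scale[OF bbg])
    show "polar_form (\<lambda>x. distr (\<mu> x) borel g) \<phi> y x = cnj (polar_form (\<lambda>x. distr (\<mu> x) borel g) \<phi> x y)"
      unfolding form[OF bb] by (rule form_herm[OF bbg])
    have meas: "g \<in> measurable (\<mu> x) borel" using g by (simp add: measurable_\<mu>)
    show "polar_form (\<lambda>x. distr (\<mu> x) borel g) \<phi> x x = complex_of_real (integral\<^sup>L (distr (\<mu> x) borel g) \<phi>)"
      unfolding form[OF bb] integral_distr[OF meas bounded_borel_measurable[OF bb]]
      by (rule form_diag[OF bbg])
  qed
qed

lemma polar_form_one: "polar_form \<mu> (\<lambda>t. 1) x y = cinner x y"
proof -
  have "integral\<^sup>L (\<mu> z) (\<lambda>t. 1) = (norm z)\<^sup>2" for z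
    by (simp add: space_\<mu> measure_\<mu>)
  then have "polar_form \<mu> (\<lambda>t. 1) x y =
      (\<Sum>k<4. \<i> ^ k * cinner (id (x + (\<i> ^ k) *\<^sub>C y)) (x + (\<i> ^ k) *\<^sub>C y)) / 4"
    unfolding polar_form_def id_apply cinner_self by simp
  also have "\<dots> = cinner (id x) y"
    by (rule polarization) (simp add: bounded_clinear_def bounded_linear_ident id_def)
  finally show ?thesis by simp
qed

text \<open>Idempotence is the property that the quadratic structure does not give, so it enters as
  \<open>mult\<close>. It makes the squared norm of \<open>E B x\<close> the mass of
  \<open>B\<close>, which turns continuity of the measure into strong convergence of the
  series.\<close>

lemma pvm_exists:
  assumes mult: "\<And>B T x y. B \<in> sets borel \<Longrightarrow> (\<And>x y. cinner (T x) y = polar_form \<mu> (indicator B) x y) \<Longrightarrow>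
     polar_form \<mu> (indicator B) (T x) y = polar_form \<mu> (indicator B) x y"
  obtains E where "projection_valued_measure E" "scalar_measure E = \<mu>"
proof -
  define E where "E B = (SOME T. bounded_clinear T \<and> (\<forall>x y. cinner (T x) y = polar_form \<mu> (indicator B) x y))"
    for B :: "real set"
  have "bounded_clinear (E B) \<and> (\<forall>x y. cinner (E B x) y = polar_form \<mu> (indicator B) x y)"
    if B: "B \<in> sets borel" for B
  proof -
    have "\<exists>T. bounded_clinear T \<and> (\<forall>x y. cinner (T x) y = polar_form \<mu> (indicator B) x y)"
      by (rule operator_of_function[OF bounded_borel_indicator[OF B]]) blast
    then show ?thesis unfolding E_def by (rule someI_ex)
  qed
  then have clin: "bounded_clinear (E B)" and form: "cinner (E B x) y = polar_form \<mu> (indicator B) x y"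
    if "B \<in> sets borel" for B x y using that by blast+
  have diag: "Re (cinner (E B x) x) = measure (\<mu> x) B" if B: "B \<in> sets borel" for B x
    unfolding form[OF B] form_diag[OF bounded_borel_indicator[OF B]] integral_indicator_\<mu>[OF B] by simp
  have sym: "cinner (E B x) y = cinner x (E B y)" if B: "B \<in> sets borel" for B x y
    unfolding cinner_commute[of x "E B y"] form[OF B]
    by (rule form_herm[OF bounded_borel_indicator[OF B]])
  have idem: "E B (E B x) = E B x" if B: "B \<in> sets borel" for B x
  proof (rule cinner_eqI)
    show "cinner (E B (E B x)) z = cinner (E B x) z" for z
      unfolding form[OF B, of "E B x"] form[OF B, of x] by (rule mult[OF B form[OF B]])
  qed
  have norm_E: "(norm (E B x))\<^sup>2 = measure (\<mu> x) B" if B: "B \<in> sets borel" for B x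
  proof -
    have "cinner (E B x) (E B x) = cinner (E B (E B x)) x" by (rule sym[OF B, symmetric])
    then show ?thesis unfolding diag[OF B, symmetric] idem[OF B] Re_cinner_self[symmetric] by simp
  qed
  have union: "E (B \<union> C) x = E B x + E C x"
    if B: "B \<in> sets borel" and C: "C \<in> sets borel" and disj: "B \<inter> C = {}" for B C x
  proof (rule cinner_eqI)
    fix z
    have ind: "indicator (B \<union> C) = (\<lambda>t. indicator B t + indicator C t :: real)"
      using disj by (intro ext) (auto simp: indicator_def)
    show "cinner (E (B \<union> C) x) z = cinner (E B x + E C x) z"
      unfolding cinner_add_left form[OF B] form[OF C] form[OF sets.Un[OF B C]] ind
      by (rule sf_plus[OF sigma_functional_polar_form]) (rule bounded_borel_indicator[OF B] bounded_borel_indicator[OF C])+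
  qed
  have sums: "(\<lambda>n. E (B n) x) sums E (\<Union>n. B n) x"
    if B: "\<And>n. B n \<in> sets borel" and disj: "disjoint_family B" for B :: "nat \<Rightarrow> real set" and x
  proof -
    interpret finite_measure "\<mu> x" by (rule finite_measure_\<mu>)
    \<comment> \<open>The remainder after \<open>N\<close> sets. The tails decrease to the empty
      set, so their masses tend to 0, and with them the norms of
      \<open>E (tail N) x\<close>.\<close>
    define tail where "tail N = (\<Union>n. B (n + N))" for N
    have tail: "tail N \<in> sets borel" for N unfolding tail_def using B by (intro sets.countable_UN) auto
    have tail_Suc: "tail N = B N \<union> tail (Suc N)" for N
    proof
      show "tail N \<subseteq> B N \<union> tail (Suc N)"
      proof
        fix t assume "t \<in> tail N"
        then obtain n where "t \<in> B (n + N)" unfolding tail_def by blast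
        then show "t \<in> B N \<union> tail (Suc N)" by (cases n) (auto simp: tail_def)
      qed
      have "B (n + Suc N) \<subseteq> tail N" for n
        unfolding tail_def by (rule order_trans[OF _ UN_upper[of "Suc n"]]) simp_all
      moreover have "B N \<subseteq> tail N"
        unfolding tail_def by (rule order_trans[OF _ UN_upper[of 0]]) simp_all
      ultimately show "B N \<union> tail (Suc N) \<subseteq> tail N"
        unfolding tail_def[of "Suc N"] by blast
    qed
    have disjD: "n = m" if "t \<in> B n" "t \<in> B m" for t n m
      using that disj by (auto simp: disjoint_family_on_def)
    have tail_disj: "B N \<inter> tail (Suc N) = {}" for N
    proof (rule equals0I)
      fix t assume "t \<in> B N \<inter> tail (Suc N)"
      then obtain n where "t \<in> B N" "t \<in> B (n + Suc N)" unfolding tail_def by blast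
      then have "N = n + Suc N" by (rule disjD)
      then show False by simp
    qed
    have step: "E (tail N) x = E (B N) x + E (tail (Suc N)) x" for N
      using union[OF B tail tail_disj, of N x] unfolding tail_Suc[of N, symmetric] .
    have partial: "E (\<Union>n. B n) x = (\<Sum>n<N. E (B n) x) + E (tail N) x" for N
    proof (induction N)
      case 0
      then show ?case by (simp add: tail_def)
    next
      case (Suc N)
      then show ?case by (simp add: step[of N] add.assoc)
    qed
    have "decseq tail"
    proof (rule decseq_SucI)
      show "tail (Suc N) \<subseteq> tail N" for N unfolding tail_Suc[of N] by (rule Un_upper2)
    qed
    moreover have "(\<Inter>N. tail N) = {}"
    proof (rule equals0I)
      fix t assume t: "t \<in> (\<Inter>N. tail N)"
      then obtain n where n: "t \<in> B (n + 0)" unfolding tail_def by blast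
      from t obtain m where "t \<in> B (m + Suc n)" unfolding tail_def by blast
      then have "m + Suc n = n + 0" using n by (rule disjD)
      then show False by simp
    qed
    ultimately have "(\<lambda>N. measure (\<mu> x) (tail N)) \<longlonglongrightarrow> 0"
      using finite_Lim_measure_decseq[of tail] tail by (auto simp: sets_\<mu>)
    then have "(\<lambda>N. (norm (E (tail N) x))\<^sup>2) \<longlonglongrightarrow> 0"
      by (simp only: norm_E[OF tail])
    then have "(\<lambda>N. sqrt ((norm (E (tail N) x))\<^sup>2)) \<longlonglongrightarrow> sqrt 0"
      by (rule tendsto_real_sqrt)
    then have "(\<lambda>N. E (tail N) x) \<longlonglongrightarrow> 0"
      by (simp add: tendsto_norm_zero_iff)
    then have "(\<lambda>N. E (\<Union>n. B n) x - E (tail N) x) \<longlonglongrightarrow> E (\<Union>n. B n) x - 0"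
      by (intro tendsto_diff tendsto_const)
    moreover have "E (\<Union>n. B n) x - E (tail N) x = (\<Sum>n<N. E (B n) x)" for N
      using partial[of N] by simp
    ultimately show ?thesis by (simp add: sums_def)
  qed
  have "E UNIV = id"
  proof
    fix x
    have "E UNIV x = x"
    proof (rule cinner_eqI)
      have "indicator UNIV = (\<lambda>t::real. 1::real)" by (simp add: fun_eq_iff)
      then show "cinner (E UNIV x) z = cinner x z" for z
        using form[of UNIV x z] polar_form_one by simp
    qed
    then show "E UNIV x = id x" by simp
  qed
  then have "projection_valued_measure E"
    unfolding projection_valued_measure_def orthogonal_projection_def
    using clin sym idem sums by (auto simp: fun_eq_iff)
  moreover have "scalar_measure E = \<mu>"
  proof
    fix x
    interpret finite_measure "\<mu> x" by (rule finite_measure_\<mu>)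
    have "scalar_measure E x = measure_of (space (\<mu> x)) (sets (\<mu> x)) (emeasure (\<mu> x))"
      unfolding scalar_measure_def space_\<mu> sets_\<mu>
    proof (rule measure_of_eq)
      fix B :: "real set" assume "B \<in> sigma_sets UNIV (sets borel)"
      then have "B \<in> sets borel" using sets.sigma_sets_eq[of "borel :: real measure"] by simp
      then show "ennreal (Re (cinner (E B x) x)) = emeasure (\<mu> x) B"
        by (simp add: diag emeasure_eq_measure)
    qed simp
    then show "scalar_measure E x = \<mu> x" by (simp add: measure_of_of_measure)
  qed
  ultimately show ?thesis by (rule that)
qed

end

section \<open>The spectral theorem for positive self-adjoint operators\<close>

context positive_contraction
begin

text \<open>The measure of \<open>R x\<close> is that of \<open>x\<close> with two factors
  \<open>t\<close>, one from each argument of the form.\<close>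

lemma integral_R:
  assumes bb: "bounded_borel \<phi>"
  shows "integral\<^sup>L (\<mu> (R x)) \<phi> = integral\<^sup>L (\<mu> x) (\<lambda>t. (indicator {0..1} t * t ^ 1) * ((indicator {0..1} t * t) * \<phi> t))"
proof -
  have h: "bounded_borel (\<lambda>t. indicator {0..1} t * t)"
    using bounded_borel_01_power[of 1] by simp
  have "complex_of_real (integral\<^sup>L (\<mu> (R x)) \<phi>) = polar_form \<mu> (\<lambda>t. (indicator {0..1} t * t) * \<phi> t) x ((R ^^ 1) x)"
    by (simp add: form_diag[OF bb, symmetric] polar_form_R[OF bb])
  also have "\<dots> = polar_form \<mu> (\<lambda>t. (indicator {0..1} t * t ^ 1) * ((indicator {0..1} t * t) * \<phi> t)) x x"
    by (rule polar_form_R_power_right[OF bounded_borel_mult[OF h bb]])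
  also have "\<dots> = complex_of_real (integral\<^sup>L (\<mu> x) (\<lambda>t. (indicator {0..1} t * t ^ 1) * ((indicator {0..1} t * t) * \<phi> t)))"
    by (rule form_diag[OF bounded_borel_mult[OF bounded_borel_01_power bounded_borel_mult[OF h bb]]])
  finally show ?thesis using of_real_eq_iff by blast
qed

text \<open>The spectral parameter \<open>t\<close> of the resolvent \<open>R = (1 + A)\<^sup>-\<^sup>1\<close> corresponds to \<open>1 / t - 1\<close> for \<open>A\<close>;
  the junk value at \<open>t = 0\<close> does not matter, since \<open>R\<close> is injective.\<close>

definition spectral_map :: "real \<Rightarrow> real" where "spectral_map t = 1 / t - 1"

lemma spectral_map_measurable: "spectral_map \<in> borel_measurable borel"
  unfolding spectral_map_def by measurable

text \<open>These two factors \<open>t\<close> cancel the pole of \<open>1/t - 1\<close>: the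
  weighted square is \<open>(1 - t)^2\<close>, at most 1 on (0,1].\<close>

lemma R_square_integrable: "R w \<in> square_integrable_vectors \<mu> spectral_map"
  unfolding square_integrable_vectors_def mem_Collect_eq
proof (rule integrable_if_dominated[OF borel_measurable_power[OF spectral_map_measurable] zero_le_power2])
  fix n
  let ?\<phi> = "\<lambda>t. min ((spectral_map t)\<^sup>2) (real n)"
  have bb: "bounded_borel ?\<phi>"
    by (rule bounded_borel_min[OF borel_measurable_power[OF spectral_map_measurable] zero_le_power2])
  let ?\<psi> = "\<lambda>t. (indicator {0..1} t * t ^ 1) * ((indicator {0..1} t * t) * ?\<phi> t)"
  have "bounded_borel ?\<psi>"
    using bounded_borel_mult[OF bounded_borel_01_power bounded_borel_mult[OF bounded_borel_01_power bb], of 1 1] by simp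
  moreover have "?\<psi> t \<le> 1" for t
  proof (cases "t \<in> {0<..1}")
    case True
    have "?\<psi> t = t\<^sup>2 * ?\<phi> t" using True by (simp add: power2_eq_square)
    also have "\<dots> \<le> t\<^sup>2 * (spectral_map t)\<^sup>2" by (intro mult_left_mono) auto
    also have "\<dots> = (1 - t)\<^sup>2" using True by (simp add: spectral_map_def power_mult_distrib[symmetric] algebra_simps)
    also have "\<dots> \<le> 1" using True by (simp add: power_le_one)
    finally show ?thesis .
  next
    case False
    then have "?\<psi> t = 0" by (cases "t = 0") (auto simp: indicator_def)
    then show ?thesis by (rule ord_eq_le_trans) simp
  qed
  ultimately have "integral\<^sup>L (\<mu> w) ?\<psi> \<le> integral\<^sup>L (\<mu> w) (\<lambda>t. 1)"
    by (intro integral_mono integrable_bounded bounded_borel_const)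
  then show "integral\<^sup>L (\<mu> (R w)) ?\<phi> \<le> (norm w)\<^sup>2"
    unfolding integral_R[OF bb] by (simp add: space_\<mu> measure_\<mu>)
qed

text \<open>The operator \<open>T\<close> for the point 0 annihilates the range of \<open>R\<close>,
  because \<open>t\<close> vanishes there; by density and continuity it is 0. This disposes of the
  point where \<open>1/t - 1\<close> is singular.\<close>

lemma polar_form_zero_set:
  assumes dense: "closure (range R) = UNIV"
  shows "polar_form \<mu> (indicator {0}) x y = 0"
proof -
  have bb: "bounded_borel (indicator {0})" by (rule bounded_borel_indicator) simp
  obtain T where T: "bounded_clinear T" "\<And>x y. cinner (T x) y = polar_form \<mu> (indicator {0}) x y"
    by (rule operator_of_function[OF bb]) blast
  have "T (R z) = 0" for z
  proof (rule cinner_eqI)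
    fix v
    have "(\<lambda>t::real. (indicator {0..1} t * t) * indicator {0} t) = (\<lambda>t. 0::real)"
      by (intro ext) (auto simp: indicator_def)
    then show "cinner (T (R z)) v = cinner 0 v"
      unfolding T(2) polar_form_R[OF bb] by (simp add: sf_zero[OF sf_polar])
  qed
  then have "range R \<subseteq> {z. T z = 0}" by blast
  moreover have "closed {z. T z = 0}"
    using T(1) by (intro closed_Collect_eq linear_continuous_on continuous_intros) (simp add: bounded_clinear_def)
  ultimately have "closure (range R) \<subseteq> {z. T z = 0}" by (rule closure_minimal)
  then have "T x = 0" using dense by blast
  then show ?thesis using T(2)[of x y] by simp
qed

text \<open>In the form at \<open>R w\<close> the function \<open>1/t - 1\<close> acquires the
  factor \<open>t\<close> and becomes \<open>1 - t\<close>, the function that belongs to the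
  operator \<open>1 - R\<close>.\<close>

lemma polar_operator_R:
  assumes dense: "closure (range R) = UNIV"
  shows "(R w, w - R w) \<in> polar_operator \<mu> spectral_map"
  unfolding polar_operator_def mem_Collect_eq prod.case
proof (intro conjI ballI R_square_integrable)
  fix z assume z: "z \<in> square_integrable_vectors \<mu> spectral_map"
  let ?f = "\<lambda>n t. indicator {t. \<bar>spectral_map t\<bar> \<le> real n} t * spectral_map t"
  \<comment> \<open>The pointwise limit of \<open>?k\<close>: it is \<open>1 - t\<close> on (0,1]
    and 0 at 0, where the third term removes the value 1.\<close>
  let ?h = "\<lambda>t::real. indicator {0..1} t * t ^ 0 - indicator {0..1} t * t ^ 1 - indicator {0} t"
  let ?k = "\<lambda>n t. (indicator {0..1} t * t) * ?f n t"
  have lim1: "(\<lambda>n. polar_form \<mu> (?f n) (R w) z) \<longlonglongrightarrow> polar_form \<mu> spectral_map (R w) z"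
    by (rule polar_form_truncation_tendsto[OF integrable_polar[OF spectral_map_measurable R_square_integrable z] spectral_map_measurable])
  have lim2: "(\<lambda>n. polar_form \<mu> (?f n) (R w) z) \<longlonglongrightarrow> polar_form \<mu> ?h w z"
    unfolding polar_form_R[OF bounded_borel_truncation[OF spectral_map_measurable]]
  proof (rule sf_limit[OF sf_polar, where C=1])
    have f: "?f n \<in> borel_measurable borel" for n
      by (rule bounded_borel_measurable[OF bounded_borel_truncation[OF spectral_map_measurable]])
    show "?k n \<in> borel_measurable borel" for n
      by (rule borel_measurable_times[OF _ f]) measurable
    show "?h \<in> borel_measurable borel"
      by (intro bounded_borel_measurable bounded_borel_diff bounded_borel_01_power bounded_borel_indicator) simp
    have tg: "t * spectral_map t = 1 - t" if "t \<noteq> 0" for t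
      using that by (simp add: spectral_map_def algebra_simps)
    show "\<bar>?k n t\<bar> \<le> 1" for n t
      using tg[of t] by (cases "t = 0") (auto simp: indicator_def)
    fix t
    show "(\<lambda>n. ?k n t) \<longlonglongrightarrow> ?h t"
    proof (rule tendsto_eventually, rule eventually_sequentiallyI)
      fix n assume "nat \<lceil>\<bar>spectral_map t\<bar>\<rceil> \<le> n"
      then have "\<bar>spectral_map t\<bar> \<le> real n" by linarith
      then show "?k n t = ?h t"
        using tg[of t] by (cases "t = 0") (auto simp: indicator_def)
    qed
  qed
  have "polar_form \<mu> ?h w z = cinner (w - R w) z"
  proof -
    have bb0: "bounded_borel (indicator {0})" by (rule bounded_borel_indicator) simp
    have "polar_form \<mu> ?h w z = polar_form \<mu> (\<lambda>t. indicator {0..1} t * t ^ 0) w z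
        - polar_form \<mu> (\<lambda>t. indicator {0..1} t * t ^ 1) w z - polar_form \<mu> (indicator {0}) w z"
      by (simp only: sf_minus[OF sf_polar bounded_borel_diff[OF bounded_borel_01_power bounded_borel_01_power] bb0]
          sf_minus[OF sf_polar bounded_borel_01_power bounded_borel_01_power])
    then show ?thesis
      unfolding polar_moment polar_form_zero_set[OF dense] by (simp add: cinner_diff_left)
  qed
  then show "cinner (w - R w) z = polar_form \<mu> spectral_map (R w) z"
    using LIMSEQ_unique[OF lim1 lim2] by simp
qed

end

theorem spectral_theorem:
  assumes sa: "self_adjoint A" and nonneg: "\<And>x y. (x, y) \<in> A \<Longrightarrow> 0 \<le> Re (cinner y x)"
  obtains E where "is_spectral_measure A E"
proof -
  obtain R where R: "bounded_clinear R" "\<And>x y. (x, y) \<in> A \<Longrightarrow> R (x + y) = x"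
    "\<And>w. (R w, w - R w) \<in> A"
    "\<And>w z. cinner (R w) z = cinner w (R z)" "\<And>w. (norm (R w))\<^sup>2 \<le> Re (cinner (R w) w)"
    using resolvent_exists[OF sa nonneg] by blast
  interpret positive_contraction R by unfold_locales (fact R)+
  have "x \<in> range R" if "(x, y) \<in> A" for x y
    using R(2)[OF that] by (metis rangeI)
  then have "Domain A \<subseteq> range R" by blast
  moreover have "closure (Domain A) = UNIV"
    using sa by (simp add: self_adjoint_def densely_defined_def)
  ultimately have dense: "closure (range R) = UNIV"
    using closure_mono[of "Domain A" "range R"] by auto
  have sub: "A \<subseteq> polar_operator \<mu> spectral_map"
  proof (rule subrelI)
    fix x y assume "(x, y) \<in> A"
    then show "(x, y) \<in> polar_operator \<mu> spectral_map"
      using polar_operator_R[OF dense, of "x + y"] by (simp add: R(2))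
  qed
  \<comment> \<open>The operator on the left is symmetric and extends \<open>A\<close>, so each of
    its pairs passes the adjoint test against \<open>A\<close>.\<close>
  have "polar_operator \<mu> spectral_map \<subseteq> A"
  proof (rule subrelI)
    fix u v assume uv: "(u, v) \<in> polar_operator \<mu> spectral_map"
    have "(u, v) \<in> A \<longleftrightarrow> (\<forall>(x, y) \<in> A. cinner y u = cinner x v)"
      by (rule graph_iff[OF sa nonneg])
    moreover have "\<forall>(x, y) \<in> A. cinner y u = cinner x v"
    proof (intro ballI, clarify)
      fix x y assume "(x, y) \<in> A"
      then have "(x, y) \<in> polar_operator \<mu> spectral_map" using sub by blast
      then show "cinner y u = cinner x v"
        using uv by (rule polar_operator_symmetric[OF spectral_map_measurable])
    qed
    ultimately show "(u, v) \<in> A" by blast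
  qed
  with sub have A: "A = polar_operator \<mu> spectral_map" by (rule equalityI)
  let ?\<nu> = "\<lambda>x. distr (\<mu> x) borel spectral_map"
  interpret \<nu>: spectral_family ?\<nu> by (rule spectral_family_distr[OF spectral_map_measurable])
  obtain E where E: "projection_valued_measure E" "scalar_measure E = ?\<nu>"
  proof (rule \<nu>.pvm_exists)
    fix B :: "real set" and T x y
    assume B: "B \<in> sets borel" and T: "\<And>x y. cinner (T x) y = polar_form ?\<nu> (indicator B) x y"
    \<comment> \<open>Idempotence for \<open>B\<close> is transported from its preimage, where it is
      \<open>polar_form_projection\<close>.\<close>
    have C: "spectral_map -` B \<in> sets borel" using measurable_sets[OF spectral_map_measurable B] by simp
    have "(\<lambda>t. indicator B (spectral_map t) :: real) = indicator (spectral_map -` B)"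
      by (intro ext) (simp add: indicator_def)
    then have form: "polar_form ?\<nu> (indicator B) x y = polar_form \<mu> (indicator (spectral_map -` B)) x y" for x y
      using polar_form_distr[OF spectral_map_measurable bounded_borel_measurable[OF bounded_borel_indicator[OF B]]] by simp
    have "(\<lambda>t. indicator (spectral_map -` B) t * indicator (spectral_map -` B) t :: real) = indicator (spectral_map -` B)"
      by (intro ext) (simp add: indicator_def)
    then show "polar_form ?\<nu> (indicator B) (T x) y = polar_form ?\<nu> (indicator B) x y"
      using polar_form_projection[OF C T[unfolded form] bounded_borel_indicator[OF C], of x y]
      by (simp only: form)
  qed blast
  have "A = spectral_integral E (\<lambda>t. t)"
    unfolding spectral_integral_eq E(2) polar_operator_distr[OF spectral_map_measurable] by (rule A)
  with E(1) that show ?thesis by (simp add: is_spectral_measure_def)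
qed

section \<open>Spectral measures of an operator and of its functions\<close>

lemma is_spectral_measure_spectral_measure:
  "is_spectral_measure A E \<Longrightarrow> is_spectral_measure A (spectral_measure A)"
  unfolding spectral_measure_def by (rule someI[of "is_spectral_measure A"])


text \<open>The operator for \<open>B\<close> is \<open>E\<close> at the preimage of
  \<open>B\<close> under \<open>g\<close>, from which idempotence is inherited. For
  \<open>sqrt\<close> this provides \<open>operator_sqrt\<close> with a spectral measure.\<close>

lemma (in pvm) spectral_measure_of_function:
  assumes g: "g \<in> borel_measurable borel"
  obtains F where "is_spectral_measure (spectral_integral E g) F"
proof -
  let ?\<nu> = "\<lambda>x. distr (scalar_measure E x) borel g"
  interpret \<nu>: spectral_family ?\<nu> by (rule spectral_family_distr[OF g])
  obtain F where F: "projection_valued_measure F" "scalar_measure F = ?\<nu>"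
  proof (rule \<nu>.pvm_exists)
    fix B :: "real set" and T x y
    assume B: "B \<in> sets borel" and T: "\<And>x y. cinner (T x) y = polar_form ?\<nu> (indicator B) x y"
    have C: "g -` B \<in> sets borel" using measurable_sets[OF g B] by simp
    have "(\<lambda>t. indicator B (g t) :: real) = indicator (g -` B)"
      by (intro ext) (simp add: indicator_def)
    then have form: "polar_form ?\<nu> (indicator B) x y = cinner (E (g -` B) x) y" for x y
      using polar_form_distr[OF g bounded_borel_measurable[OF bounded_borel_indicator[OF B]]]
      by (simp add: polar_form_indicator[OF C])
    have "T x = E (g -` B) x"
      by (rule cinner_eqI) (simp only: T form)
    then show "polar_form ?\<nu> (indicator B) (T x) y = polar_form ?\<nu> (indicator B) x y"
      by (simp only: form E_idem[OF C])
  qed blast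
  have "spectral_integral E g = spectral_integral F (\<lambda>t. t)"
    unfolding spectral_integral_eq F(2) polar_operator_distr[OF g] ..
  with F(1) that show ?thesis by (simp add: is_spectral_measure_def)
qed

lemma (in pvm) spectral_integral_nonneg:
  assumes neg: "\<And>x. E {..<0} x = 0" and g: "g \<in> borel_measurable borel" "\<And>t. 0 \<le> t \<Longrightarrow> 0 \<le> g t"
    and xy: "(x, y) \<in> spectral_integral E g"
  shows "0 \<le> Re (cinner y x)"
proof -
  have "AE t in scalar_measure E x. 0 \<le> t"
  proof (rule AE_I[of _ _ "{..<0}"])
    show "emeasure (scalar_measure E x) {..<0} = 0"
      by (simp add: emeasure_scalar_measure neg)
  qed (auto simp: sets_\<mu>)
  then have "AE t in scalar_measure E x. 0 \<le> g t"
    by eventually_elim (rule g(2))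
  then have "0 \<le> integral\<^sup>L (scalar_measure E x) g" by (rule integral_nonneg_AE)
  then show ?thesis
    using polar_operator_quadratic_form[OF g(1), of x y] xy by (simp add: spectral_integral_eq)
qed

lemma spectral_measure_negative_eq_0:
  assumes A: "is_spectral_measure A E" and nonneg: "\<And>x y. (x, y) \<in> A \<Longrightarrow> 0 \<le> Re (cinner y x)"
  shows "E {..<0} x = 0"
proof -
  interpret pvm E using A by unfold_locales (simp add: is_spectral_measure_def)
  have "A = polar_operator (scalar_measure E) (\<lambda>t. t)"
    using A by (simp add: is_spectral_measure_def spectral_integral_eq)
  then show ?thesis using E_neg_eq_0 nonneg by simp
qed

section \<open>Decomposition into dyadic bands\<close>

text \<open>Band \<open>n\<close> ends at \<open>2 ^ n\<close>, and band \<open>Suc j\<close>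
  belongs to the index \<open>j\<close> of the series. Half-open intervals keep the bands disjoint
  without leaving gaps.\<close>

definition dyadic_band :: "nat \<Rightarrow> real set" where
  "dyadic_band n = (case n of 0 \<Rightarrow> {0..1} | Suc j \<Rightarrow> {2 ^ j<..2 ^ (j + 1)})"

lemma dyadic_band_borel: "dyadic_band n \<in> sets borel"
  by (simp add: dyadic_band_def split: nat.split)

lemma dyadic_band_subset: "dyadic_band n \<subseteq> {0..2 ^ n}"
proof -
  have "(0::real) \<le> t" if "2 ^ j < t" for j t
    using that zero_le_power[of "2::real" j] by linarith
  then show ?thesis by (auto simp: dyadic_band_def split: nat.split)
qed

lemma dyadic_band_less:
  assumes "m < n" "s \<in> dyadic_band m" "t \<in> dyadic_band n"
  shows "s < t"
proof -
  obtain j where n: "n = Suc j" using assms(1) by (cases n) auto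
  have "s \<le> 2 ^ m" using assms(2) dyadic_band_subset[of m] by auto
  also have "(2::real) ^ m \<le> 2 ^ j" using assms(1) n by (intro power_increasing) auto
  also have "\<dots> < t" using assms(3) by (simp add: n dyadic_band_def)
  finally show ?thesis .
qed

lemma dyadic_band_disjoint: "disjoint_family dyadic_band"
  unfolding disjoint_family_on_def
proof (intro ballI impI equals0I)
  fix m n t assume "m \<noteq> n" "t \<in> dyadic_band m \<inter> dyadic_band n"
  then show False
    using dyadic_band_less[of m n t t] dyadic_band_less[of n m t t] by (cases m n rule: linorder_cases) auto
qed

lemma dyadic_band_UN: "(\<Union>n. dyadic_band n) = {0..}"
proof (intro equalityI subsetI)
  fix t :: real assume "t \<in> (\<Union>n. dyadic_band n)"
  then show "t \<in> {0..}" using dyadic_band_subset by fastforce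
next
  fix t :: real assume "t \<in> {0..}"
  then have "0 \<le> t" by simp
  obtain N where "t < 2 ^ N" using real_arch_pow[of 2 t] by auto
  then have ex: "\<exists>n. t \<le> 2 ^ n" by (intro exI[of _ N]) simp
  \<comment> \<open>The first power of 2 not below \<open>t\<close> selects the band; minimality
    gives the strict lower end.\<close>
  define n where "n = (LEAST n. t \<le> 2 ^ n)"
  have n: "t \<le> 2 ^ n" unfolding n_def using ex by (rule LeastI_ex)
  have "t \<in> dyadic_band n"
  proof (cases n)
    case 0
    then show ?thesis using n \<open>0 \<le> t\<close> by (simp add: dyadic_band_def)
  next
    case (Suc j)
    then have "\<not> t \<le> 2 ^ j" using not_less_Least[of j "\<lambda>n. t \<le> 2 ^ n"] unfolding n_def[symmetric] by simp
    then show ?thesis using n Suc by (simp add: dyadic_band_def)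
  qed
  then show "t \<in> (\<Union>n. dyadic_band n)" by blast
qed

lemma (in pvm) dyadic_band_sums:
  assumes neg: "E {..<0} f = 0"
  shows "(\<lambda>n. E (dyadic_band n) f) sums f"
proof -
  have "(\<lambda>n. E (dyadic_band n) f) sums E {0..} f"
    using E_sums[OF dyadic_band_borel dyadic_band_disjoint] by (simp only: dyadic_band_UN)
  moreover have "{..<0} \<union> {0..} = (UNIV :: real set)" "{..<0} \<inter> {0..} = ({} :: real set)" by auto
  then have "E {..<0} f + E {0..} f = E UNIV f"
    using E_union[of "{..<0}" "{0..}" f] by auto
  ultimately show ?thesis using neg by (simp add: E_UNIV)
qed

section \<open>Decomposition of a vector along the spectrum of \<open>D\<close>\<close>

theorem lemma1p2:
  fixes \<Delta> D :: "'a::complex_hilbert operator_graph"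
  assumes "self_adjoint \<Delta>" and "positive_definite \<Delta>" and "D = operator_sqrt \<Delta>"
  shows "\<forall>f :: 'a. \<exists>(fs :: nat \<Rightarrow> 'a) (g :: 'a) (Ss :: nat \<Rightarrow> 'a \<Rightarrow> 'a) (S :: 'a \<Rightarrow> 'a).
    (\<forall>j. fs j \<in> paley_wiener D (2 ^ (j + 1))) \<and>
    g \<in> paley_wiener D 1 \<and>
    (\<forall>j. bounded_clinear (Ss j) \<and> range (Ss j) \<subseteq> paley_wiener D (2 ^ (j + 1))) \<and>
    bounded_clinear S \<and> range S \<subseteq> paley_wiener D 1 \<and>
    summable (\<lambda>j. Ss j (fs j)) \<and>
    f = S g + (\<Sum>j. Ss j (fs j))"
proof
  fix f :: 'a
  have nonneg: "0 \<le> Re (cinner y x)" if "(x, y) \<in> \<Delta>" for x y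
    using assms(2) that by (cases "x = 0") (auto simp: positive_definite_def less_imp_le)
  define E where "E = spectral_measure \<Delta>"
  obtain E\<^sub>0 where "is_spectral_measure \<Delta> E\<^sub>0"
    using spectral_theorem[OF assms(1) nonneg] by blast
  then have E: "is_spectral_measure \<Delta> E"
    unfolding E_def by (rule is_spectral_measure_spectral_measure)
  interpret E: pvm E using E by unfold_locales (simp add: is_spectral_measure_def)
  have sqrt: "sqrt \<in> borel_measurable borel" by measurable
  have D: "D = spectral_integral E sqrt"
    by (simp add: assms(3) operator_sqrt_def E_def)
  define G where "G = spectral_measure D"
  obtain F where "is_spectral_measure D F"
    using E.spectral_measure_of_function[OF sqrt] D by blast
  then have G: "is_spectral_measure D G"
    unfolding G_def by (rule is_spectral_measure_spectral_measure)
  interpret G: pvm G using G by unfold_locales (simp add: is_spectral_measure_def)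
  \<comment> \<open>The real \<open>sqrt\<close> is odd, hence negative on the negative half-line;
    \<open>D\<close> is nonnegative because \<open>E\<close> vanishes there.\<close>
  have "0 \<le> Re (cinner y x)" if "(x, y) \<in> D" for x y
    using E.spectral_integral_nonneg[OF spectral_measure_negative_eq_0[OF E nonneg] sqrt] that
    by (simp add: D)
  then have "G {..<0} f = 0"
    by (rule spectral_measure_negative_eq_0[OF G])
  then have sums: "(\<lambda>n. G (dyadic_band n) f) sums f" by (rule G.dyadic_band_sums)
  have mem: "G (dyadic_band n) h \<in> paley_wiener D (2 ^ n)" for n h
  proof -
    have "G {0..2 ^ n} (G (dyadic_band n) h) = G (dyadic_band n) h"
      by (rule G.E_subset) (simp_all add: dyadic_band_borel dyadic_band_subset)
    then show ?thesis unfolding paley_wiener_def G_def[symmetric] by (metis rangeI)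
  qed
  \<comment> \<open>Each component is fixed by its own projection, so applying the operators to the
    chosen vectors returns the components of \<open>f\<close>.\<close>
  note idem = G.E_idem[OF dyadic_band_borel]
  \<comment> \<open>The term \<open>n = 0\<close> is split off as \<open>S g\<close>; the shift by
    one matches band \<open>Suc j\<close> with the bandwidth \<open>2 ^ (j + 1)\<close>.\<close>
  have "(\<lambda>j. G (dyadic_band (Suc j)) f) sums (f - G (dyadic_band 0) f)"
    using sums_Suc_iff[of "\<lambda>n. G (dyadic_band n) f" "f - G (dyadic_band 0) f"] sums by simp
  then have tail: "summable (\<lambda>j. G (dyadic_band (Suc j)) f)"
    "f = G (dyadic_band 0) f + (\<Sum>j. G (dyadic_band (Suc j)) f)"
    by (simp_all add: sums_iff algebra_simps)
  have mem0: "G (dyadic_band 0) h \<in> paley_wiener D 1" for h using mem[of 0 h] by simp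
  have memS: "G (dyadic_band (Suc j)) h \<in> paley_wiener D (2 ^ (j + 1))" for j h
    using mem[of "Suc j" h] by simp
  show "\<exists>(fs :: nat \<Rightarrow> 'a) (g :: 'a) (Ss :: nat \<Rightarrow> 'a \<Rightarrow> 'a) (S :: 'a \<Rightarrow> 'a).
    (\<forall>j. fs j \<in> paley_wiener D (2 ^ (j + 1))) \<and>
    g \<in> paley_wiener D 1 \<and>
    (\<forall>j. bounded_clinear (Ss j) \<and> range (Ss j) \<subseteq> paley_wiener D (2 ^ (j + 1))) \<and>
    bounded_clinear S \<and> range S \<subseteq> paley_wiener D 1 \<and>
    summable (\<lambda>j. Ss j (fs j)) \<and>
    f = S g + (\<Sum>j. Ss j (fs j))"
  proof (rule exI[of _ "\<lambda>j. G (dyadic_band (Suc j)) f"], rule exI[of _ "G (dyadic_band 0) f"],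
      rule exI[of _ "\<lambda>j. G (dyadic_band (Suc j))"], rule exI[of _ "G (dyadic_band 0)"], intro conjI allI)
    show "f = G (dyadic_band 0) (G (dyadic_band 0) f) +
        (\<Sum>j. G (dyadic_band (Suc j)) (G (dyadic_band (Suc j)) f))"
      unfolding idem by (rule tail(2))
    show "summable (\<lambda>j. G (dyadic_band (Suc j)) (G (dyadic_band (Suc j)) f))"
      unfolding idem by (rule tail(1))
  qed (use mem0 memS G.bounded_clinear_E[OF dyadic_band_borel] in \<open>auto simp only: image_subset_iff\<close>)
qed

end
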